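(* There exists a submeasure algebra $\mathcal{B}$ that is not a measure algebra. In fact, there does not exist a positive measure on $\mathcal{B}$, and there does not exist a non-zero continuous measure on $\mathcal{B}$ either.
   Context: For a Boolean algebra $\mathcal{B}$ (not necessarily represented as an algebra of sets), $0$ and $1$ denote its smallest and largest elements, and $\cap,\cup,\subset$, etc. denote its operations and order. $\mathcal{B}$ is $\sigma$-complete if every countable subset has a least upper bound (and hence a greatest lower bound). A submeasure on $\mathcal{B}$ is a map $\nu:\mathcal{B}\to[0,\infty)$ with $\nu(0)=0$, monotone ($A\subset B\Rightarrow\nu(A)\le\nu(B)$) and subadditive ($\nu(A\cup B)\le\nu(A)+\nu(B)$). It is a measure (finitely additive) if $\nu(A\cup B)=\nu(A)+\nu(B)$ whenever $A\cap B=0$. A submeasure $\nu$ is continuous if $\lim_{n\to\infty}\nu(A_n)=0$ for every decreasing sequence $(A_n)$ with $\bigcap_nA_n=0$. It is positive if $\nu(A)=0$ implies $A=0$. A submeasure algebra is a $\sigma$-complete Boolean algebra on which there is a positive continuous submeasure; a measure algebra is a $\sigma$-complete Boolean algebra on which there is a positive continuous measure. *)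

theory Defs
  imports Complex_Main "HOL-Library.Countable_Set" "HOL-Algebra.Lattice"
begin

text \<open>
  Boolean algebras are carrier-based orders of type \<^typ>\<open>'a gorder\<close>, so that one can quantify over
  them in a formula.  The locale \<^locale>\<open>bounded_lattice\<close> makes the equivalence component of the
  record plain equality; \<open>\<sqsubseteq>\<close>, \<open>\<sqinter>\<close>, \<open>\<squnion>\<close>, \<open>\<bottom>\<close>, \<open>\<top>\<close> stand for the inclusion, intersection,
  union, 0 and 1 of the algebra.
\<close>

locale boolean_lattice = bounded_lattice +
  assumes meet_join_distrib:
      "\<lbrakk>x \<in> carrier L; y \<in> carrier L; z \<in> carrier L\<rbrakk>
        \<Longrightarrow> x \<sqinter> (y \<squnion> z) = (x \<sqinter> y) \<squnion> (x \<sqinter> z)"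
    and complement_exists:
      "x \<in> carrier L \<Longrightarrow> \<exists>y\<in>carrier L. x \<sqinter> y = \<bottom> \<and> x \<squnion> y = \<top>"

locale sigma_complete_boolean_lattice = boolean_lattice +
  assumes countable_sup_exists:
    "\<lbrakk>A \<subseteq> carrier L; countable A\<rbrakk> \<Longrightarrow> \<exists>s. is_lub L s A"

text \<open>
  The set functions below are HOL functions on the whole type \<^typ>\<open>'a\<close>; only their values on the
  carrier are constrained.
\<close>

definition submeasure :: "'a gorder \<Rightarrow> ('a \<Rightarrow> real) \<Rightarrow> bool" where
  "submeasure B \<nu> \<longleftrightarrow>
     (\<forall>a\<in>carrier B. 0 \<le> \<nu> a) \<and>
     \<nu> \<bottom>\<^bsub>B\<^esub> = 0 \<and>
     (\<forall>a\<in>carrier B. \<forall>b\<in>carrier B. a \<sqsubseteq>\<^bsub>B\<^esub> b \<longrightarrow> \<nu> a \<le> \<nu> b) \<and>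
     (\<forall>a\<in>carrier B. \<forall>b\<in>carrier B. \<nu> (a \<squnion>\<^bsub>B\<^esub> b) \<le> \<nu> a + \<nu> b)"

text \<open>Only finite additivity is required of a measure.\<close>

definition finadd_measure :: "'a gorder \<Rightarrow> ('a \<Rightarrow> real) \<Rightarrow> bool" where
  "finadd_measure B \<nu> \<longleftrightarrow>
     submeasure B \<nu> \<and>
     (\<forall>a\<in>carrier B. \<forall>b\<in>carrier B. a \<sqinter>\<^bsub>B\<^esub> b = \<bottom>\<^bsub>B\<^esub> \<longrightarrow> \<nu> (a \<squnion>\<^bsub>B\<^esub> b) = \<nu> a + \<nu> b)"

definition continuous_submeasure :: "'a gorder \<Rightarrow> ('a \<Rightarrow> real) \<Rightarrow> bool" where
  "continuous_submeasure B \<nu> \<longleftrightarrow>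
     submeasure B \<nu> \<and>
     (\<forall>A :: nat \<Rightarrow> 'a.
        (\<forall>n. A n \<in> carrier B) \<and> (\<forall>n. A (Suc n) \<sqsubseteq>\<^bsub>B\<^esub> A n) \<and> is_glb B \<bottom>\<^bsub>B\<^esub> (range A)
        \<longrightarrow> (\<lambda>n. \<nu> (A n)) \<longlonglongrightarrow> 0)"

definition positive_submeasure :: "'a gorder \<Rightarrow> ('a \<Rightarrow> real) \<Rightarrow> bool" where
  "positive_submeasure B \<nu> \<longleftrightarrow>
     submeasure B \<nu> \<and> (\<forall>a\<in>carrier B. \<nu> a = 0 \<longrightarrow> a = \<bottom>\<^bsub>B\<^esub>)"

definition submeasure_algebra :: "'a gorder \<Rightarrow> bool" where
  "submeasure_algebra B \<longleftrightarrow>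
     sigma_complete_boolean_lattice B \<and>
     (\<exists>\<nu>. submeasure B \<nu> \<and> positive_submeasure B \<nu> \<and> continuous_submeasure B \<nu>)"

definition measure_algebra :: "'a gorder \<Rightarrow> bool" where
  "measure_algebra B \<longleftrightarrow>
     sigma_complete_boolean_lattice B \<and>
     (\<exists>\<mu>. finadd_measure B \<mu> \<and> positive_submeasure B \<mu> \<and> continuous_submeasure B \<mu>)"

end

(* A simplified form of Talagrand's construction.  Sets X of sequences come with a finite index set I
   and a weight that is small when I is large; (X, I) is admissible at level k if between any two
   positions m < n of I every atom of rank m contains a set of rank n that misses X and is large for
   the submeasure of level k+1.  The submeasure of level k is the cheapest cover by admissible sets of
   levels >= k.  The recursion over the levels goes downwards, so it is started at a finite level p
   and an ultrafilter limit over p is taken.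

   - The whole space cannot be covered cheaply: the few level-k sets of a cover are assigned disjoint
     gaps of their index sets in which the sets of higher level have little weight; every set of
     higher level is localized to a single gap or to a single interval between gaps, and a point
     outside the cover is built interval by interval.
   - The limit is exhaustive: up to a set of small submeasure, some member of a disjoint sequence
     avoids, in each atom of rank m, a set of rank n that is large at level k+1.  Iterating this N k
     times makes it admissible at level k, hence of submeasure about 2^-k.
   - Sets avoiding one prescribed value in each of N k coordinates are admissible at level k, yet
     every finitely additive measure is almost concentrated on such a set.

   The algebra is the completion of the clopen algebra modulo null sets. *)

theory Submission
  imports Defs
begin

section \<open>Cylinder sets\<close>

text \<open>Two demands conflict: cheap sets must be plentiful enough to defeat every measure and to
  absorb disjoint sequences, yet the whole space must stay expensive. The weights reconcile them.
  Keeping only a share 2^-(l+5) of the indices of a piece of level l multiplies its weight by at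
  most 2^(1/(l+5)^2), and these factors have a bounded product over all levels. The fourth power in
  \<open>N\<close> forces every piece of weight below 32 to have at least 2^(2l+20) indices, enough
  to reserve gaps for all level-l pieces of a cover, of which there are fewer than 2^(l+5).

  The ultrafilter is there because \<open>thin\<close> is antitone in the class it refers to:
  enlarging the class of level k+1 shrinks the set of new pieces of level k, so the approximations
  need not be monotone in the starting level and have no obvious limit.

  The thresholds 1, 2, 4, 8 come from halving index sets, which at most doubles a weight. One
  doubling is lost in passing to the limit, two in proving exhaustivity, and 2 + 8 < 16 leaves a set
  that is still large.\<close>

text \<open>The space is \<open>{0} \<times> {0,1} \<times> {0,1,2} \<times> \<dots>\<close>.  Clipping the coordinate \<open>z i\<close> to \<open>min (z i) i\<close>
  identifies it with a quotient of the whole type \<^typ>\<open>nat \<Rightarrow> nat\<close>, so that no carrier set has to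
  be carried around.\<close>

definition agree :: "nat \<Rightarrow> (nat \<Rightarrow> nat) \<Rightarrow> (nat \<Rightarrow> nat) \<Rightarrow> bool" where
  "agree r z z' \<longleftrightarrow> (\<forall>i<r. min (z i) i = min (z' i) i)"

text \<open>The preimage of X under \<open>graft u m\<close> is the part of X in the atom of rank m
  through u, stretched to the whole space. This rescaling lets covers of an atom be compared with
  covers of everything.\<close>

definition graft :: "(nat \<Rightarrow> nat) \<Rightarrow> nat \<Rightarrow> (nat \<Rightarrow> nat) \<Rightarrow> nat \<Rightarrow> nat" where
  "graft u m z = (\<lambda>i. if i < m then u i else z i)"

definition shadow :: "nat \<Rightarrow> (nat \<Rightarrow> nat) set \<Rightarrow> (nat \<Rightarrow> nat) set" where
  "shadow r X = {z. \<exists>x\<in>X. agree r x z}"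

definition cylinder :: "nat \<Rightarrow> (nat \<Rightarrow> nat) set \<Rightarrow> bool" where
  "cylinder r X \<longleftrightarrow> (\<forall>x z. agree r x z \<longrightarrow> x \<in> X \<longrightarrow> z \<in> X)"

text \<open>One canonical point, clipped and zero from m on, for each atom of rank m.\<close>

definition reps :: "nat \<Rightarrow> (nat \<Rightarrow> nat) set" where
  "reps m = {u. \<forall>i. u i \<le> i \<and> (m \<le> i \<longrightarrow> u i = 0)}"

lemma agree_refl [simp]: "agree r z z"
  and agree_sym: "agree r z z' \<Longrightarrow> agree r z' z"
  and agree_trans: "agree r z z' \<Longrightarrow> agree r z' z'' \<Longrightarrow> agree r z z''"
  and agree_mono: "agree r z z' \<Longrightarrow> m \<le> r \<Longrightarrow> agree m z z'"
  by (auto simp: agree_def)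

lemma agree_graft: "agree m (graft u m z) u"
  and agree_graft2: "agree m u v \<Longrightarrow> agree n x y \<Longrightarrow> agree n (graft u m x) (graft v m y)"
  and agree_graft_same: "agree m u z \<Longrightarrow> agree r (graft u m z) z"
  by (auto simp: agree_def graft_def)

lemma graft_0 [simp]: "graft u 0 z = z"
  by (simp add: graft_def)

lemma graft_graft: "m \<le> m' \<Longrightarrow> graft u m (graft v m' z) = graft (graft u m v) m' z"
  and graft_graft_inner: "m' \<le> m \<Longrightarrow> graft u m (graft v m' z) = graft u m z"
  by (auto simp: graft_def)

lemma shadow_extensive: "X \<subseteq> shadow r X"
  unfolding shadow_def using agree_refl by blast

lemma shadow_antimono: "m \<le> r \<Longrightarrow> shadow r X \<subseteq> shadow m X"
  by (auto simp: shadow_def intro: agree_mono)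

lemma shadow_shadow: "m \<le> r \<Longrightarrow> shadow m (shadow r X) = shadow m X"
  unfolding shadow_def by (auto intro: agree_mono agree_trans) (use agree_refl in blast)

lemma cylinder_shadow: "m \<le> r \<Longrightarrow> cylinder r (shadow m X)"
  by (auto simp: cylinder_def shadow_def intro: agree_trans agree_mono)

lemma cylinder_mono: "cylinder m X \<Longrightarrow> m \<le> r \<Longrightarrow> cylinder r X"
  by (meson agree_mono cylinder_def)

lemma cylinderD: "cylinder r X \<Longrightarrow> agree r x z \<Longrightarrow> x \<in> X \<longleftrightarrow> z \<in> X"
  by (meson agree_sym cylinder_def)

lemma cylinder_Compl: "cylinder r X \<Longrightarrow> cylinder r (- X)"
  and cylinder_Un: "cylinder r X \<Longrightarrow> cylinder r Y \<Longrightarrow> cylinder r (X \<union> Y)"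
  and cylinder_Int: "cylinder r X \<Longrightarrow> cylinder r Y \<Longrightarrow> cylinder r (X \<inter> Y)"
  and cylinder_UN: "(\<And>a. a \<in> S \<Longrightarrow> cylinder r (G a)) \<Longrightarrow> cylinder r (\<Union>a\<in>S. G a)"
  and cylinder_empty: "cylinder r {}"
  and cylinder_UNIV: "cylinder r UNIV"
  by (auto simp: cylinder_def dest: agree_sym)

lemma cylinder_agree: "cylinder m {z. agree m u z}"
  by (auto simp: cylinder_def intro: agree_trans)

lemma cylinder_vimage_graft: "cylinder n X \<Longrightarrow> cylinder n (graft u m -` X)"
  unfolding cylinder_def vimage_def using agree_graft2[of m u u n] by auto

lemma vimage_graft_cong: "cylinder n X \<Longrightarrow> agree m u v \<Longrightarrow> graft u m -` X = graft v m -` X"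
  unfolding vimage_def using cylinderD[OF _ agree_graft2[of m u v n, OF _ agree_refl]] by blast

lemma shadow_subset_cylinder: "cylinder r Y \<Longrightarrow> X \<subseteq> Y \<Longrightarrow> shadow r X \<subseteq> Y"
  by (auto simp: cylinder_def shadow_def)

text \<open>A witness y for the right-hand side agrees with u below m, but only after clipping. As Y
  is a cylinder, the literal entries of u may replace those of y, after which the entries of z can
  be put beneath them.\<close>

lemma shadow_vimage_graft:
  assumes "m \<le> n" "cylinder r Y"
  shows "shadow n (graft u m -` Y) = graft u m -` shadow n Y"
proof (intro equalityI subsetI)
  fix z assume "z \<in> shadow n (graft u m -` Y)"
  then show "z \<in> graft u m -` shadow n Y"
    unfolding shadow_def using agree_graft2[of m u u n] by auto
next
  fix z assume "z \<in> graft u m -` shadow n Y"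
  then obtain y where y: "y \<in> Y" "agree n y (graft u m z)" by (auto simp: shadow_def)
  have "agree m y u"
    using y(2) assms(1) agree_graft agree_mono agree_trans by blast
  then have "agree r (graft u m y) y"
    by (simp add: agree_graft_same agree_sym)
  then have "graft u m (graft z m y) \<in> Y"
    using y(1) assms(2) cylinderD by (simp add: graft_graft_inner)
  moreover have "agree n (graft z m y) z"
    using y(2) by (auto simp: agree_def graft_def)
  ultimately show "z \<in> shadow n (graft u m -` Y)"
    unfolding shadow_def by auto
qed

lemma finite_reps: "finite (reps m)"
proof (rule finite_subset)
  show "reps m \<subseteq> {u. \<forall>i. (i \<in> {..<m} \<longrightarrow> u i \<in> {..m}) \<and> (i \<notin> {..<m} \<longrightarrow> u i = 0)}"
    unfolding reps_def by (auto simp: not_less) (meson le_trans less_imp_le)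
  show "finite {u. \<forall>i. (i \<in> {..<m} \<longrightarrow> u i \<in> {..m}) \<and> (i \<notin> {..<m} \<longrightarrow> u i = (0::nat))}"
    by (rule finite_set_of_finite_funs) auto
qed

lemma rep_exists: "\<exists>u\<in>reps m. agree m u z"
  by (rule bexI[of _ "\<lambda>i. if i < m then min (z i) i else 0"]) (auto simp: reps_def agree_def)

text \<open>A cylinder is a union of some of the finitely many atoms of its rank. This feeds the
  pigeonhole in \<open>absorb\<close> and, through \<open>rank_pieces\<close>, the freezing of
  covers along the ultrafilter.\<close>

lemma finite_cylinders: "finite {X. cylinder r X}"
proof -
  have "X = (\<Union>u\<in>X \<inter> reps r. {z. agree r u z})" if "cylinder r X" for X
  proof (intro equalityI subsetI)
    fix z assume z: "z \<in> X"
    obtain u where u: "u \<in> reps r" "agree r u z" using rep_exists by blast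
    then have "u \<in> X" using z cylinderD[OF that] by blast
    then show "z \<in> (\<Union>u\<in>X \<inter> reps r. {z. agree r u z})" using u by blast
  next
    fix z assume "z \<in> (\<Union>u\<in>X \<inter> reps r. {z. agree r u z})"
    then show "z \<in> X" using cylinderD[OF that] by blast
  qed
  then have "{X. cylinder r X} \<subseteq> (\<lambda>U. \<Union>u\<in>U. {z. agree r u z}) ` Pow (reps r)"
    by blast
  then show ?thesis
    using finite_reps by (meson finite_Pow_iff finite_imageI finite_subset)
qed

section \<open>Weighted covers\<close>

text \<open>In terms of \<open>N l\<close> this weight is \<open>2\<^sup>-\<^sup>l (N l / i) powr (1 / (l+5)\<^sup>3)\<close>.\<close>

definition wt :: "nat \<Rightarrow> nat \<Rightarrow> real" where
  "wt l i = 2 powr ((real ((l+5)^4 + 2*l+20) - log 2 (real i)) / real ((l+5)^3) - real l)"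

definition N :: "nat \<Rightarrow> nat" where
  "N l = 2 ^ ((l+5)^4 + 2*l+20)"

lemma wt_pos: "0 < wt l i"
  by (simp add: wt_def)

lemma log_N: "log 2 (real (N l)) = real ((l+5)^4 + 2*l+20)"
  by (simp add: N_def log_nat_power del: of_nat_add)

lemma wt_N: "wt l (N l) = 2 powr (- real l)"
  by (simp add: wt_def log_N)

lemma wt_ge:
  assumes "0 < i" "i \<le> N l"
  shows "2 powr (- real l) \<le> wt l i"
proof -
  have "log 2 (real i) \<le> log 2 (real (N l))"
    using assms by simp
  then show ?thesis
    unfolding wt_def log_N by simp
qed

text \<open>The loss of l+5 in the logarithm is divided by (l+5)^3. The resulting 1/(l+5)^2 is
  summable over the levels, which is the reason for the cube.\<close>

lemma wt_scale:
  assumes "0 < i" "0 < j" "i \<le> 2 ^ (l + 5) * j"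
  shows "wt l j \<le> 2 powr (1 / real ((l+5)^2)) * wt l i"
proof -
  have "real i \<le> real (2 ^ (l + 5) * j)"
    using assms by (simp only: of_nat_le_iff)
  then have "log 2 (real i) \<le> log 2 (2 ^ (l + 5) * real j)"
    using assms by (subst log_le_cancel_iff) auto
  also have "\<dots> = real (l+5) + log 2 (real j)"
    using assms by (simp add: log_mult log_nat_power)
  finally have "(real ((l+5)^4 + 2*l+20) - log 2 (real j)) / real ((l+5)^3) \<le>
     (real (l+5) + (real ((l+5)^4 + 2*l+20) - log 2 (real i))) / real ((l+5)^3)"
    by (intro divide_right_mono) auto
  also have "\<dots> = 1 / real ((l+5)^2) + (real ((l+5)^4 + 2*l+20) - log 2 (real i)) / real ((l+5)^3)"
  proof -
    have "real (l+5) / real ((l+5)^3) = 1 / real ((l+5)^2)"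
      by (simp add: power2_eq_square power3_eq_cube)
    then show ?thesis by (metis add_divide_distrib)
  qed
  finally show ?thesis
    unfolding wt_def powr_add[symmetric] by simp
qed

text \<open>The bound 32 = 2^5 and the shift by -l leave a quotient below l+5, hence a numerator
  below (l+5)^4. What remains of the numerator's constant, 2l+20, bounds log i from below.\<close>

lemma wt_small:
  assumes "0 < i" "wt l i < 32"
  shows "2 ^ (2*l+20) \<le> i"
proof -
  have "wt l i < 2 powr 5" using assms by (simp add: powr_numeral)
  then have "(real ((l+5)^4 + 2*l+20) - log 2 (real i)) / real ((l+5)^3) < real (l + 5)"
    unfolding wt_def by (subst (asm) powr_less_cancel_iff) auto
  then have "real ((l+5)^4 + 2*l+20) - log 2 (real i) < real (l + 5) * real ((l+5)^3)"
    by (subst (asm) pos_divide_less_eq) auto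
  also have "\<dots> = real ((l+5)^4)"
    by (simp flip: of_nat_mult power_Suc)
  finally have "real (2*l+20) < log 2 (real i)" by simp
  then have "2 powr real (2*l+20) < real i"
    using assms(1) by (simp add: less_log_iff)
  then have "real (2 ^ (2*l+20)) < real i"
    by (subst (asm) powr_realpow) auto
  then show ?thesis by linarith
qed

text \<open>A piece \<open>(l, I, X)\<close> is the set \<open>X\<close> with level \<open>l\<close> and index set \<open>I\<close>.  An index \<open>n \<in> I\<close> marks the
  cut between the coordinates \<open>n - 1\<close> and \<open>n\<close>.\<close>

type_synonym piece = "nat \<times> nat set \<times> (nat \<Rightarrow> nat) set"

abbreviation lv :: "piece \<Rightarrow> nat" where "lv \<equiv> fst"
abbreviation ix :: "piece \<Rightarrow> nat set" where "ix x \<equiv> fst (snd x)"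
abbreviation st :: "piece \<Rightarrow> (nat \<Rightarrow> nat) set" where "st x \<equiv> snd (snd x)"

definition weight :: "piece \<Rightarrow> real" where
  "weight x = wt (lv x) (card (ix x))"

text \<open>Says that the submeasure of B generated by C is below t. The predicate avoids an
  infimum, which would range over the empty set for the empty class at the base of
  \<open>approx\<close>.\<close>

definition cov :: "piece set \<Rightarrow> (nat \<Rightarrow> nat) set \<Rightarrow> real \<Rightarrow> bool" where
  "cov C B t \<longleftrightarrow> (\<exists>F. finite F \<and> F \<subseteq> C \<and> B \<subseteq> \<Union>(st ` F) \<and> sum weight F < t)"

lemma weight_pos: "0 < weight x"
  by (simp add: weight_def wt_pos)

lemma sum_weight_nonneg: "0 \<le> sum weight F"
  by (simp add: sum_nonneg weight_pos less_imp_le)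

lemma sum_weight_mono: "finite G \<Longrightarrow> F \<subseteq> G \<Longrightarrow> sum weight F \<le> sum weight G"
  by (intro sum_mono2) (auto simp: weight_pos less_imp_le)

lemma cov_mono: "cov C B t \<Longrightarrow> C \<subseteq> C' \<Longrightarrow> B' \<subseteq> B \<Longrightarrow> t \<le> t' \<Longrightarrow> cov C' B' t'"
  unfolding cov_def by (meson order_less_le_trans order_trans)

lemma cov_pos: "cov C B t \<Longrightarrow> 0 < t"
  unfolding cov_def using sum_weight_nonneg order_le_less_trans by blast

lemma cov_empty: "0 < t \<Longrightarrow> cov C {} t"
  unfolding cov_def by (intro exI[of _ "{}"]) auto

lemma cov_Un:
  assumes "cov C A s" "cov C B t"
  shows "cov C (A \<union> B) (s + t)"
proof -
  obtain F G where F: "finite F" "F \<subseteq> C" "A \<subseteq> \<Union>(st ` F)" "sum weight F < s"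
    and G: "finite G" "G \<subseteq> C" "B \<subseteq> \<Union>(st ` G)" "sum weight G < t"
    using assms unfolding cov_def by blast
  have "sum weight (F \<union> G) \<le> sum weight F + sum weight G"
    using sum_Un2[of F G weight] F(1) G(1) sum_weight_nonneg[of "F \<inter> G"] sum.union_inter[of F G weight]
    by linarith
  then show ?thesis
    unfolding cov_def using F G by (intro exI[of _ "F \<union> G"]) auto
qed

lemma cov_UN:
  assumes "finite S" "\<And>a. a \<in> S \<Longrightarrow> cov C (A a) (t a)" "sum t S < t'"
  shows "cov C (\<Union>a\<in>S. A a) t'"
proof -
  have "cov C (\<Union>a\<in>S. A a) (sum t S + e)" if "0 < e" for e
    using assms(1,2)
  proof (induction S)
    case empty
    then show ?case using that by (auto intro: cov_empty)
  next
    case (insert a S)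
    then have "cov C (A a \<union> (\<Union>a\<in>S. A a)) (t a + (sum t S + e))"
      by (intro cov_Un) auto
    then show ?case using insert by (simp add: add.assoc)
  qed
  from this[of "t' - sum t S"] assms(3) show ?thesis by simp
qed

text \<open>Closure under localization: restrict to an atom of rank m, coarsen to rank n, keep some
  indices in between. As a property of classes it lets the same arguments serve
  \<open>approx\<close> and \<open>limit\<close>.\<close>

definition stable :: "piece set \<Rightarrow> bool" where
  "stable C \<longleftrightarrow> (\<forall>x\<in>C. finite (ix x) \<and> ix x \<noteq> {} \<and> card (ix x) \<le> N (lv x) \<and>
     (\<forall>u m n J. m \<le> n \<longrightarrow> J \<noteq> {} \<longrightarrow> J \<subseteq> ix x \<inter> {m..n} \<longrightarrow>
        (lv x, J, graft u m -` shadow n (st x)) \<in> C))"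

lemma stableD:
  assumes "stable C" "x \<in> C"
  shows "finite (ix x)" "ix x \<noteq> {}" "card (ix x) \<le> N (lv x)" "0 < card (ix x)"
    and "m \<le> n \<Longrightarrow> J \<noteq> {} \<Longrightarrow> J \<subseteq> ix x \<inter> {m..n} \<Longrightarrow> (lv x, J, graft u m -` shadow n (st x)) \<in> C"
  using assms unfolding stable_def by (simp_all add: card_gt_0_iff)

lemma stable_Un: "stable C \<Longrightarrow> stable D \<Longrightarrow> stable (C \<union> D)"
  unfolding stable_def ball_Un by (simp only: Un_iff simp_thms) blast

lemma weight_ge:
  assumes "stable C" "x \<in> C"
  shows "2 powr (- real (lv x)) \<le> weight x"
  using stableD[OF assms] unfolding weight_def by (intro wt_ge)

lemma weight_small:
  assumes "stable C" "x \<in> C" "weight x < 32"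
  shows "2 ^ (2 * lv x + 20) \<le> card (ix x)"
  using stableD[OF assms(1,2)] assms(3) unfolding weight_def by (intro wt_small)

text \<open>A piece with a share 2^-(l+5) of its indices in the interval can be replaced by its
  localization, at most K times as heavy by \<open>wt_scale\<close>. Distinct pieces may get the
  same localization, which only lowers the sum.\<close>

lemma localize:
  fixes u :: "nat \<Rightarrow> nat"
  assumes "stable C" "finite F" "F \<subseteq> C" "m \<le> n"
    and ix: "\<And>x. x \<in> F \<Longrightarrow> card (ix x) \<le> 2 ^ (lv x + 5) * card (ix x \<inter> {m..n})"
    and K: "\<And>x. x \<in> F \<Longrightarrow> 2 powr (1 / real ((lv x + 5)^2)) \<le> K"
  defines "G \<equiv> (\<lambda>x. (lv x, ix x \<inter> {m..n}, graft u m -` shadow n (st x))) ` F"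
  shows "finite G" "G \<subseteq> C" "sum weight G \<le> K * sum weight F"
    "\<Union>(st ` G) = (\<Union>x\<in>F. graft u m -` shadow n (st x))"
proof -
  have ne: "0 < card (ix x \<inter> {m..n})" if "x \<in> F" for x
    using ix[OF that] stableD(4)[OF assms(1)] that assms(3) by (metis bot_nat_0.not_eq_extremum le_zero_eq mult_0_right subsetD)
  show "finite G" unfolding G_def using assms by auto
  show "G \<subseteq> C" unfolding G_def
  proof (rule image_subsetI)
    fix x assume x: "x \<in> F"
    then have "ix x \<inter> {m..n} \<noteq> {}" using ne by fastforce
    then show "(lv x, ix x \<inter> {m..n}, graft u m -` shadow n (st x)) \<in> C"
      using x assms(3) by (intro stableD(5)[OF assms(1) _ assms(4)]) auto
  qed
  show "\<Union>(st ` G) = (\<Union>x\<in>F. graft u m -` shadow n (st x))"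
    unfolding G_def by auto
  have "sum weight G \<le> (\<Sum>x\<in>F. weight (lv x, ix x \<inter> {m..n}, graft u m -` shadow n (st x)))"
    unfolding G_def using sum_image_le[OF assms(2), of weight] weight_pos
    by (simp add: less_imp_le o_def)
  also have "\<dots> \<le> (\<Sum>x\<in>F. K * weight x)"
  proof (rule sum_mono)
    fix x assume x: "x \<in> F"
    have "wt (lv x) (card (ix x \<inter> {m..n})) \<le> 2 powr (1 / real ((lv x + 5)^2)) * wt (lv x) (card (ix x))"
      using stableD(4)[OF assms(1)  subsetD[OF assms(3) x]] ne[OF x] ix[OF x] by (rule wt_scale)
    also have "\<dots> \<le> K * wt (lv x) (card (ix x))"
      using K[OF x] wt_pos by (simp add: mult_right_mono less_imp_le)
    finally show "weight (lv x, ix x \<inter> {m..n}, graft u m -` shadow n (st x)) \<le> K * weight x"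
      by (simp add: weight_def)
  qed
  finally show "sum weight G \<le> K * sum weight F"
    by (simp add: sum_distrib_left)
qed

lemma cov_localize:
  assumes "stable C" "finite F" "F \<subseteq> C" "m \<le> n"
    and "\<And>x. x \<in> F \<Longrightarrow> card (ix x) \<le> 2 ^ (lv x + 5) * card (ix x \<inter> {m..n})"
    and "\<And>x. x \<in> F \<Longrightarrow> 2 powr (1 / real ((lv x + 5)^2)) \<le> K"
    and "K * sum weight F < t" "B \<subseteq> (\<Union>x\<in>F. graft u m -` shadow n (st x))"
  shows "cov C B t"
  unfolding cov_def using localize[OF assms(1-6), of u] assms(7,8)
  by (intro exI[of _ "(\<lambda>x. (lv x, ix x \<inter> {m..n}, graft u m -` shadow n (st x))) ` F"]) auto

lemma scale_le_2: "2 powr (1 / real ((l + 5)^2)) \<le> (2::real)"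
proof -
  have "1 / real ((l + 5)^2) \<le> 1" by (simp add: divide_le_eq)
  then have "2 powr (1 / real ((l + 5)^2)) \<le> (2::real) powr 1"
    by (intro powr_mono) auto
  then show ?thesis by simp
qed

text \<open>The complement of \<open>shadow n X\<close> is the largest set of rank \<open>n\<close> disjoint from \<open>X\<close>, so it is the
  best candidate for the set \<open>C\<close> in Talagrand's definition of \<open>(m, n, \<nu>)\<close>-thinness.\<close>

definition thin :: "piece set \<Rightarrow> nat set \<Rightarrow> (nat \<Rightarrow> nat) set \<Rightarrow> bool" where
  "thin C I X \<longleftrightarrow> (\<forall>m\<in>I. \<forall>n\<in>I. m < n \<longrightarrow> (\<forall>u. \<not> cov C (graft u m -` (- shadow n X)) 1))"

definition thin_pieces :: "nat \<Rightarrow> piece set \<Rightarrow> piece set" where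
  "thin_pieces k C = {(l, I, X). l = k \<and> finite I \<and> I \<noteq> {} \<and> card I \<le> N k \<and> thin C I X}"

text \<open>Sections compose: testing the localized set between m' and n' along v is testing X
  between m' and n' along \<open>graft u m v\<close>.\<close>

lemma thin_localize:
  assumes "thin C I X" "J \<subseteq> I \<inter> {m..n}" "m \<le> n"
  shows "thin C J (graft u m -` shadow n X)"
  unfolding thin_def
proof (intro ballI impI allI)
  fix m' n' v assume *: "m' \<in> J" "n' \<in> J" "m' < n'"
  then have mn: "m \<le> m'" "m \<le> n'" "n' \<le> n" using assms(2) by auto
  have "shadow n' (graft u m -` shadow n X) = graft u m -` shadow n' X"
    using shadow_vimage_graft[OF mn(2) cylinder_shadow[OF order_refl]] shadow_shadow[OF mn(3)] by metis
  then have "graft v m' -` (- shadow n' (graft u m -` shadow n X)) =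
      graft (graft u m v) m' -` (- shadow n' X)"
    using mn by (auto simp: graft_graft)
  then show "\<not> cov C (graft v m' -` (- shadow n' (graft u m -` shadow n X))) 1"
    using assms(1,2) * unfolding thin_def by (metis le_inf_iff subsetD)
qed

lemma stable_thin_pieces: "stable (thin_pieces k C)"
  unfolding stable_def
proof (intro ballI conjI allI impI)
  fix x u m n J
  assume x: "x \<in> thin_pieces k C" and J: "m \<le> n" "J \<noteq> {}" "J \<subseteq> ix x \<inter> {m..n}"
  then have "card J \<le> card (ix x)" "finite J"
    by (auto simp: thin_pieces_def intro: finite_subset card_mono)
  then show "(lv x, J, graft u m -` shadow n (st x)) \<in> thin_pieces k C"
    using x J thin_localize[of C "ix x" "st x" J m n u] by (auto simp: thin_pieces_def)
qed (auto simp: thin_pieces_def)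

text \<open>\<open>approx k j\<close> is Talagrand's class \<open>C\<^bsub>k,k+j\<^esub>\<close>, started from the empty class.\<close>

fun approx :: "nat \<Rightarrow> nat \<Rightarrow> piece set" where
  "approx k 0 = {}"
| "approx k (Suc j) = approx (Suc k) j \<union> thin_pieces k (approx (Suc k) j)"

lemma stable_approx: "stable (approx k j)"
  by (induction k j rule: approx.induct) (auto simp: stable_thin_pieces stable_Un, simp add: stable_def)

lemma lv_approx: "x \<in> approx k j \<Longrightarrow> k \<le> lv x"
  by (induction k j rule: approx.induct) (auto simp: thin_pieces_def)

section \<open>The lower bound\<close>

text \<open>The intervals are crossed from left to right. Once the coordinates below
  \<open>t j\<close> are fixed, the failure to cover the section supplies a continuation, and
  everything demanded earlier has rank at most \<open>t j\<close>, so it survives.\<close>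

lemma thread:
  fixes t :: "nat \<Rightarrow> nat" and Z :: "nat \<Rightarrow> (nat \<Rightarrow> nat) set" and P :: "nat \<Rightarrow> piece set"
  assumes "mono t" "\<And>i. i < q \<Longrightarrow> cylinder (t (Suc i)) (Z i)"
    and step: "\<And>i u. i < q \<Longrightarrow>
      \<not> graft u (t i) -` Z i \<subseteq> (\<Union>x\<in>P i. graft u (t i) -` shadow (t (Suc i)) (st x))"
  shows "\<exists>z. \<forall>i<q. z \<in> Z i \<and> (\<forall>x\<in>P i. z \<notin> st x)"
proof -
  have "\<exists>z. \<forall>i<j. z \<in> Z i \<and> (\<forall>x\<in>P i. z \<notin> shadow (t (Suc i)) (st x))" if "j \<le> q" for j
    using that
  proof (induction j)
    case (Suc j)
    then obtain u where u: "\<And>i. i < j \<Longrightarrow> u \<in> Z i \<and> (\<forall>x\<in>P i. u \<notin> shadow (t (Suc i)) (st x))"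
      by (metis Suc_leD)
    have "j < q" using Suc.prems by simp
    then obtain z where z: "graft u (t j) z \<in> Z j"
        "\<forall>x\<in>P j. graft u (t j) z \<notin> shadow (t (Suc j)) (st x)"
      using step[of j u] by blast
    have "graft u (t j) z \<in> Z i \<and> (\<forall>x\<in>P i. graft u (t j) z \<notin> shadow (t (Suc i)) (st x))" if "i < Suc j" for i
    proof (cases "i = j")
      case False
      then have "i < j" "t (Suc i) \<le> t j" using that \<open>mono t\<close> by (auto simp: mono_def)
      then have "agree (t (Suc i)) u (graft u (t j) z)"
        using agree_graft agree_mono agree_sym by blast
      then show ?thesis
        using u[OF \<open>i < j\<close>] cylinderD[OF assms(2)[of i]] cylinderD[OF cylinder_shadow[OF order_refl]]
          \<open>i < j\<close> \<open>j < q\<close> by (meson order_less_trans)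
    qed (use z in auto)
    then show ?case by blast
  qed auto
  then show ?thesis
    using shadow_extensive by (metis order_refl subsetD)
qed

text \<open>Greedy choice: the next gap goes to the set whose g-th index from r on comes first.
  Every other set has fewer than g indices before that point, so enough remain for the induction.
  The intervals from \<open>t (2*j+1)\<close> to \<open>t (2*j+2)\<close> are the gaps, the others
  lie between them.\<close>

lemma disjoint_gaps:
  fixes I :: "'x \<Rightarrow> nat set" and good :: "'x \<Rightarrow> nat \<Rightarrow> nat \<Rightarrow> bool"
  assumes "finite R" "0 < g" "r \<le> M"
    and "\<And>x. x \<in> R \<Longrightarrow> card R * g \<le> card (I x \<inter> {r..M})"
    and good: "\<And>x a b. x \<in> R \<Longrightarrow> g \<le> card (I x \<inter> {a..b}) \<Longrightarrow>
      \<exists>m n. m \<in> I x \<and> n \<in> I x \<and> a \<le> m \<and> m < n \<and> n \<le> b \<and> good x m n"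
  shows "\<exists>t e. mono t \<and> t 0 = r \<and> t (2 * card R + 1) = M \<and> (\<forall>i. t i \<le> M) \<and> e ` {..<card R} = R \<and>
    (\<forall>j<card R. t (2*j+1) \<in> I (e j) \<and> t (2*j+2) \<in> I (e j) \<and> t (2*j+1) < t (2*j+2) \<and>
       good (e j) (t (2*j+1)) (t (2*j+2)))"
  using assms(1,3-)
proof (induction "card R" arbitrary: R r)
  case 0
  then show ?case
    by (intro exI[of _ "\<lambda>i. if i = 0 then r else M"]) (auto simp: mono_def)
next
  case (Suc s)
  define b where "b x = (LEAST b. g \<le> card (I x \<inter> {r..b}))" for x
  have ex: "g \<le> card (I x \<inter> {r..M})" if "x \<in> R" for x
    using Suc.prems(3)[OF that] Suc.hyps(2) by (metis dual_order.trans le_add1 mult_Suc)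
  have b1: "g \<le> card (I x \<inter> {r..b x})" "b x \<le> M" if "x \<in> R" for x
    unfolding b_def using LeastI[of "\<lambda>b. g \<le> card (I x \<inter> {r..b})", OF ex[OF that]] Least_le[of "\<lambda>b. g \<le> card (I x \<inter> {r..b})", OF ex[OF that]]
    by auto
  have b2: "card (I x \<inter> {r..<c}) < g" if "x \<in> R" "c \<le> b x" for x c
  proof (cases c)
    case 0
    then show ?thesis using \<open>0 < g\<close> by simp
  next
    case (Suc c')
    then have "c' < b x" using that by simp
    then have "\<not> g \<le> card (I x \<inter> {r..c'})" unfolding b_def by (rule not_less_Least)
    then show ?thesis using Suc by (simp add: atLeastLessThanSuc_atLeastAtMost)
  qed
  have "R \<noteq> {}" using Suc.hyps(2) by auto
  then obtain x where x: "x \<in> R" "\<And>y. y \<in> R \<Longrightarrow> b x \<le> b y"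
    using arg_min_if_finite[OF Suc.prems(1), of b] arg_min_least[OF Suc.prems(1)] by blast
  obtain m n where mn: "m \<in> I x" "n \<in> I x" "r \<le> m" "m < n" "n \<le> b x" "good x m n"
    using Suc.prems(4)[OF x(1) b1(1)[OF x(1)]] by blast
  have card': "card (R - {x}) = s" using Suc.hyps(2) x(1) Suc.prems(1) by simp
  have nM: "n \<le> M" using mn(5) b1(2)[OF x(1)] by simp
  have "card (R - {x}) * g \<le> card (I y \<inter> {n..M})" if y: "y \<in> R - {x}" for y
  proof -
    have "I y \<inter> {r..M} \<subseteq> (I y \<inter> {r..<b x}) \<union> (I y \<inter> {n..M})" using mn(5) by auto
    then have "card (I y \<inter> {r..M}) \<le> card (I y \<inter> {r..<b x}) + card (I y \<inter> {n..M})"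
      by (meson card_Un_le card_mono finite_Int finite_UnI finite_atLeastAtMost finite_atLeastLessThan order_trans)
    moreover have "card (I y \<inter> {r..<b x}) < g" using b2 x y by blast
    moreover have "g + s * g \<le> card (I y \<inter> {r..M})"
      using Suc.prems(3)[of y] y Suc.hyps(2) by (metis DiffD1 mult_Suc)
    ultimately show ?thesis using card' by simp
  qed
  then obtain t e where te: "mono t" "t 0 = n" "t (2 * s + 1) = M" "\<And>i. t i \<le> M" "e ` {..<s} = R - {x}"
    "\<And>j. j < s \<Longrightarrow> t (2*j+1) \<in> I (e j) \<and> t (2*j+2) \<in> I (e j) \<and> t (2*j+1) < t (2*j+2) \<and>
       good (e j) (t (2*j+1)) (t (2*j+2))"
    using Suc.hyps(1)[of "R - {x}" n] card' Suc.prems(1,4) nM by (metis DiffD1 finite_Diff)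
  define t' where "t' i = (if i = 0 then r else if i = 1 then m else t (i - 2))" for i
  define e' where "e' j = (if j = 0 then x else e (j - 1))" for j
  have tn: "n \<le> t i" for i using te(1,2) by (metis le0 monoD)
  have "mono t'"
    unfolding mono_def t'_def using mn te(1) tn
    by (auto intro: order_trans[OF _ tn] monoD[OF te(1)])
  moreover have "t' 0 = r" "t' (2 * card R + 1) = M" "\<forall>i. t' i \<le> M"
    using te(3,4) Suc.hyps(2) mn nM by (auto simp: t'_def simp flip: Suc.hyps(2))
  moreover have "e' ` {..<card R} = R"
  proof -
    have "e' ` {..<card R} = insert x (e ` {..<s})"
      unfolding Suc.hyps(2)[symmetric] lessThan_Suc_eq_insert_0 image_insert image_image
      by (auto simp: e'_def)
    then show ?thesis using te(5) x(1) by auto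
  qed
  moreover have "t' (2*j+1) \<in> I (e' j) \<and> t' (2*j+2) \<in> I (e' j) \<and> t' (2*j+1) < t' (2*j+2) \<and>
       good (e' j) (t' (2*j+1)) (t' (2*j+2))" if "j < card R" for j
  proof (cases j)
    case 0
    then show ?thesis using mn te(2) by (simp add: t'_def e'_def)
  next
    case (Suc j')
    then show ?thesis using te(6)[of j'] that Suc.hyps(2) by (simp add: t'_def e'_def)
  qed
  ultimately show ?case by blast
qed

text \<open>Averaging: consecutive elements of S are paired into 2^(k+12) + 1 disjoint intervals,
  and a piece can have a share 2^-(k+6) of its indices in at most 2^(k+6) of them. If every interval
  carried weight 1/2, the total would exceed 32 * 2^(k+6) = 2^(k+11).\<close>

lemma light_gap:
  assumes "finite F" "\<And>y. y \<in> F \<Longrightarrow> finite (ix y) \<and> 0 < card (ix y)"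
    and "sum weight F < 32" "finite S" "2 * (2 ^ (k + 12) + 1) \<le> card S"
  shows "\<exists>m n. m \<in> S \<and> n \<in> S \<and> m < n \<and>
    sum weight {y\<in>F. card (ix y) \<le> 2 ^ (k + 6) * card (ix y \<inter> {m..n})} < 1/2"
proof (rule ccontr)
  assume neg: "\<not> ?thesis"
  define G :: nat where "G = 2 ^ (k + 12) + 1"
  define xs where "xs = sorted_list_of_set S"
  have xs: "sorted_wrt (<) xs" "set xs = S" "length xs = card S"
    unfolding xs_def using assms(4) by auto
  define L where "L j = {xs ! (2*j) .. xs ! (2*j+1)}" for j
  define sig where "sig y j \<longleftrightarrow> card (ix y) \<le> 2 ^ (k + 6) * card (ix y \<inter> L j)" for y j
  have len: "2 * j + 1 < length xs" if "j < G" for j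
  proof -
    have "2 * G \<le> length xs" using assms(5) xs(3) unfolding G_def by simp
    then show ?thesis using that by linarith
  qed
  have bad: "1/2 \<le> (\<Sum>y\<in>F. if sig y j then weight y else 0)" if "j < G" for j
  proof -
    have "xs ! (2*j) \<in> S" "xs ! (2*j+1) \<in> S" "xs ! (2*j) < xs ! (2*j+1)"
      using len[OF that] xs by (auto simp: sorted_wrt_nth_less)
    then have "1/2 \<le> sum weight {y\<in>F. sig y j}"
      using neg unfolding sig_def L_def by (meson not_le)
    then show ?thesis using assms(1) by (simp add: sum.inter_filter)
  qed
  have disj: "L i \<inter> L j = {}" if "i < j" "j < G" for i j
  proof -
    have "xs ! (2*i+1) < xs ! (2*j)"
      using len[OF that(2)] that xs(1) by (intro sorted_wrt_nth_less[of "(<)" xs]) auto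
    then show ?thesis by (auto simp: L_def)
  qed
  have few: "card {j\<in>{..<G}. sig y j} \<le> 2 ^ (k + 6)" if y: "y \<in> F" for y
  proof -
    let ?J = "{j\<in>{..<G}. sig y j}"
    have "card ?J * card (ix y) = (\<Sum>j\<in>?J. card (ix y))" by simp
    also have "\<dots> \<le> (\<Sum>j\<in>?J. 2 ^ (k + 6) * card (ix y \<inter> L j))"
      by (intro sum_mono) (auto simp: sig_def)
    also have "\<dots> = 2 ^ (k + 6) * card (\<Union>j\<in>?J. ix y \<inter> L j)"
    proof -
      have "(\<Sum>j\<in>?J. card (ix y \<inter> L j)) = card (\<Union>j\<in>?J. ix y \<inter> L j)"
      proof (rule card_UN_disjoint[symmetric])
        show "\<forall>i\<in>?J. \<forall>j\<in>?J. i \<noteq> j \<longrightarrow> (ix y \<inter> L i) \<inter> (ix y \<inter> L j) = {}"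
        proof (intro ballI impI)
          fix i j assume "i \<in> ?J" "j \<in> ?J" "i \<noteq> j"
          then have "L i \<inter> L j = {}" using disj[of i j] disj[of j i] by (auto simp: neq_iff)
          then show "(ix y \<inter> L i) \<inter> (ix y \<inter> L j) = {}" by blast
        qed
      qed (use assms(2) y in auto)
      then show ?thesis by (simp add: sum_distrib_left[symmetric])
    qed
    also have "\<dots> \<le> 2 ^ (k + 6) * card (ix y)"
      using assms(2) y by (intro mult_left_mono card_mono) auto
    finally show ?thesis using assms(2)[OF y] by simp
  qed
  have "real G * (1/2) \<le> (\<Sum>j<G. \<Sum>y\<in>F. if sig y j then weight y else 0)"
    using sum_mono[of "{..<G}" "\<lambda>_. 1/2 :: real", OF bad] by simp
  also have "\<dots> = (\<Sum>y\<in>F. \<Sum>j<G. if sig y j then weight y else 0)"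
    by (rule sum.swap)
  also have "\<dots> = (\<Sum>y\<in>F. weight y * real (card {j\<in>{..<G}. sig y j}))"
    by (simp add: sum.If_cases Int_def mult.commute)
  also have "\<dots> \<le> (\<Sum>y\<in>F. weight y * 2 ^ (k + 6))"
  proof (intro sum_mono mult_left_mono)
    fix y assume "y \<in> F"
    then have "real (card {j\<in>{..<G}. sig y j}) \<le> real (2 ^ (k + 6))"
      using few of_nat_le_iff by blast
    then show "real (card {j\<in>{..<G}. sig y j}) \<le> 2 ^ (k + 6)" by simp
  qed (simp add: weight_pos less_imp_le)
  also have "\<dots> = sum weight F * 2 ^ (k + 6)" by (simp add: sum_distrib_right)
  also have "\<dots> \<le> 32 * 2 ^ (k + 6)" using assms(3) by simp
  also have "\<dots> = 2 ^ (k + 12) / 2" by (simp add: power_add)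
  finally show False unfolding G_def by simp
qed

section \<open>Passing from level k+1 to level k\<close>

lemma mono_intervals_cover:
  fixes t :: "nat \<Rightarrow> nat"
  assumes "mono t"
  shows "{t 0..t (Suc q)} \<subseteq> (\<Union>i<Suc q. {t i..t (Suc i)})"
proof (induction q)
  case (Suc q)
  have "{t 0..t (Suc (Suc q))} \<subseteq> {t 0..t (Suc q)} \<union> {t (Suc q)..t (Suc (Suc q))}" by auto
  then show ?case using Suc by (auto simp: lessThan_Suc)
qed auto

text \<open>The bound rises with the level because the step down to level k costs one localization
  factor: 1/(k+6)^2 is at most the telescoping increment 1/(k+5) - 1/(k+6).\<close>

definition bnd :: "nat \<Rightarrow> real" where
  "bnd k = 2 powr (5 - 1 / real (k + 5))"

lemma bnd_le: "bnd k < 32"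
proof -
  have "bnd k < 2 powr 5" unfolding bnd_def by (intro powr_less_mono) auto
  then show ?thesis by (simp add: powr_numeral)
qed

lemma bnd_ge: "16 \<le> bnd k"
proof -
  have "1 / real (k + 5) \<le> 1" by simp
  then have "(2::real) powr 4 \<le> bnd k" unfolding bnd_def by (intro powr_mono) auto
  then show ?thesis by (simp add: powr_numeral)
qed

lemma bnd_step: "2 powr (1 / real ((k + 6)^2)) * bnd k \<le> bnd (Suc k)"
proof -
  have "1 / real ((k + 6)^2) \<le> 1 / (real (k + 5) * real (k + 6))"
    by (intro divide_left_mono) (auto simp: power2_eq_square intro: mult_right_mono)
  also have "\<dots> = 1 / real (k + 5) - 1 / real (k + 6)"
    by (simp add: field_simps)
  finally show ?thesis
    unfolding bnd_def powr_add[symmetric] by (intro powr_mono) (auto simp: add.commute)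
qed

lemma interval_pigeonhole:
  fixes t :: "nat \<Rightarrow> nat"
  assumes "mono t" "I \<subseteq> {t 0..t (Suc q)}" "Suc q \<le> c"
  shows "\<exists>i<Suc q. card I \<le> c * card (I \<inter> {t i..t (Suc i)})"
proof (rule ccontr)
  assume neg: "\<not> ?thesis"
  have fin: "finite I" using assms(2) finite_subset by blast
  have "I = (\<Union>i<Suc q. I \<inter> {t i..t (Suc i)})"
    using mono_intervals_cover[OF assms(1), of q] assms(2) by auto
  then have "card I \<le> (\<Sum>i<Suc q. card (I \<inter> {t i..t (Suc i)}))"
    using card_UN_le[of "{..<Suc q}" "\<lambda>i. I \<inter> {t i..t (Suc i)}"] by simp
  then have "c * card I \<le> (\<Sum>i<Suc q. c * card (I \<inter> {t i..t (Suc i)}))"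
    by (metis mult_le_mono2 sum_distrib_left)
  also have "\<dots> < (\<Sum>i<Suc q. card I)"
    using neg by (intro sum_strict_mono) (auto simp: not_le)
  also have "\<dots> = Suc q * card I" by simp
  also have "\<dots> \<le> c * card I" using assms(3) by (intro mult_le_mono1)
  finally show False by simp
qed

lemma lower_bound_step:
  assumes C: "stable C" "\<And>x. x \<in> C \<Longrightarrow> k < lv x" and nc: "\<not> cov C UNIV (bnd (Suc k))"
  shows "\<not> cov (C \<union> thin_pieces k C) UNIV (bnd k)"
proof
  assume "cov (C \<union> thin_pieces k C) UNIV (bnd k)"
  then obtain F where F: "finite F" "F \<subseteq> C \<union> thin_pieces k C" "UNIV \<subseteq> \<Union>(st ` F)" "sum weight F < bnd k"
    unfolding cov_def by blast
  have st: "stable (C \<union> thin_pieces k C)" using C(1) stable_thin_pieces stable_Un by blast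
  define F1 where "F1 = {x\<in>F. lv x = k}"
  define F2 where "F2 = {x\<in>F. lv x \<noteq> k}"
  have lvF1: "lv x = k" if "x \<in> F1" for x using that by (simp add: F1_def)
  have F1: "finite F1" "F1 \<subseteq> thin_pieces k C" and F2: "finite F2" "F2 \<subseteq> C" and F12: "F = F1 \<union> F2"
    using F(1,2) C(2) by (auto simp: F1_def F2_def thin_pieces_def)
  have sum32: "sum weight F < 32" using F(4) bnd_le[of k] by linarith
  have w32: "weight x < 32" if "x \<in> F" for x
    using sum_weight_mono[of F "{x}"] F(1) that sum32 by simp
  define s where "s = card F1"
  \<comment> \<open>Each piece of level k weighs at least 2^-k, and the total is below 32 =
    2^5.\<close>
  have "s < 2 ^ (k + 5)"
  proof -
    have "real s * 2 powr (- real k) = (\<Sum>x\<in>F1. 2 powr (- real k))" by (simp add: s_def)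
    also have "\<dots> \<le> sum weight F1"
      using weight_ge[OF st subsetD[OF F(2)]] lvF1 F12 by (intro sum_mono) fastforce
    also have "\<dots> \<le> sum weight F" using F12 F(1) by (intro sum_weight_mono) auto
    finally have "real s * 2 powr (- real k) < 32" using sum32 by linarith
    then have "real s < 32 * 2 ^ k" by (simp add: powr_minus powr_realpow divide_simps)
    then have "real s < real (2 ^ (k + 5))" by (simp add: power_add)
    then show ?thesis by (simp only: of_nat_less_iff)
  qed
  define M where "M = Max (insert 0 (\<Union>x\<in>F. ix x))"
  have fin: "finite (ix x)" "0 < card (ix x)" if "x \<in> F" for x
    using stableD(1,4)[OF st subsetD[OF F(2) that]] by simp_all
  have M: "ix x \<subseteq> {0..M}" if "x \<in> F" for x
  proof
    fix i assume "i \<in> ix x"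
    moreover have "finite (insert 0 (\<Union>x\<in>F. ix x))" using fin F(1) by simp
    ultimately show "i \<in> {0..M}" unfolding M_def using that by (intro iffD2[OF atLeastAtMost_iff] conjI Max_ge) auto
  qed
  define light where "light m n \<longleftrightarrow>
    sum weight {y\<in>F2. card (ix y) \<le> 2 ^ (k + 6) * card (ix y \<inter> {m..n})} < 1/2" for m n
  \<comment> \<open>The number of indices that \<open>light_gap\<close> consumes, at most 2^(k+14).
    The s gaps together use at most 2^(2k+19) indices, and \<open>weight_small\<close> provides
    2^(2k+20).\<close>
  define g :: nat where "g = 2 * (2 ^ (k + 12) + 1)"
  have "\<exists>t e. mono t \<and> t 0 = 0 \<and> t (2 * card F1 + 1) = M \<and> (\<forall>i. t i \<le> M) \<and> e ` {..<card F1} = F1 \<and>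
    (\<forall>j<card F1. t (2*j+1) \<in> ix (e j) \<and> t (2*j+2) \<in> ix (e j) \<and> t (2*j+1) < t (2*j+2) \<and>
       light (t (2*j+1)) (t (2*j+2)))"
  proof (rule disjoint_gaps[where g = g and good = "\<lambda>_. light"])
    show "0 < g" by (simp add: g_def)
  next
    fix x assume x: "x \<in> F1"
    then have xF: "x \<in> F" by (simp add: F12)
    have "card F1 * g \<le> 2 ^ (k + 5) * 2 ^ (k + 14)"
      unfolding s_def[symmetric] using \<open>s < 2 ^ (k + 5)\<close>
      by (intro mult_mono) (auto simp: g_def power_add)
    also have "\<dots> = 2 ^ ((k + 5) + (k + 14))" by (rule power_add[symmetric])
    also have "\<dots> \<le> (2::nat) ^ (2 * lv x + 20)" using lvF1[OF x] by (intro power_increasing) auto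
    also have "\<dots> \<le> card (ix x)"
      by (rule weight_small[OF st subsetD[OF F(2) xF] w32[OF xF]])
    also have "ix x = ix x \<inter> {0..M}" by (rule Int_absorb2[OF M[OF xF], symmetric])
    finally show "card F1 * g \<le> card (ix x \<inter> {0..M})" .
  next
    fix x a b assume x: "x \<in> F1" and "g \<le> card (ix x \<inter> {a..b})"
    moreover have "sum weight F2 < 32"
      using sum_weight_mono[of F F2] F(1) F12 sum32 by auto
    ultimately have "\<exists>m n. m \<in> ix x \<inter> {a..b} \<and> n \<in> ix x \<inter> {a..b} \<and> m < n \<and> light m n"
      unfolding light_def g_def using fin F2(1) F12 by (intro light_gap) auto
    then show "\<exists>m n. m \<in> ix x \<and> n \<in> ix x \<and> a \<le> m \<and> m < n \<and> n \<le> b \<and> light m n" by auto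
  qed (use F1(1) in auto)
  then obtain t e where te: "mono t" "t 0 = 0" "t (2 * s + 1) = M" "e ` {..<s} = F1"
    and gap: "\<And>j. j < s \<Longrightarrow> t (2*j+1) \<in> ix (e j) \<and> t (2*j+2) \<in> ix (e j) \<and> t (2*j+1) < t (2*j+2) \<and>
       light (t (2*j+1)) (t (2*j+2))"
    unfolding s_def by blast
  \<comment> \<open>There are 2s + 1 \<le> 2^(k+6) intervals, so some interval keeps a share
    2^-(k+6) of the indices. A piece of level l > k can afford this because k + 6 \<le> l +
    5.\<close>
  have "\<forall>y\<in>F2. \<exists>i<Suc (2*s). card (ix y) \<le> 2 ^ (k + 6) * card (ix y \<inter> {t i..t (Suc i)})"
  proof
    fix y assume "y \<in> F2"
    then have "ix y \<subseteq> {t 0..t (Suc (2*s))}" using te M F12 by auto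
    moreover have "Suc (2*s) \<le> 2 ^ (k + 6)" using \<open>s < 2 ^ (k + 5)\<close> by (simp add: power_add)
    ultimately show "\<exists>i<Suc (2*s). card (ix y) \<le> 2 ^ (k + 6) * card (ix y \<inter> {t i..t (Suc i)})"
      using interval_pigeonhole[OF te(1)] by blast
  qed
  then obtain a where a: "\<And>y. y \<in> F2 \<Longrightarrow> a y < Suc (2*s)"
      "\<And>y. y \<in> F2 \<Longrightarrow> card (ix y) \<le> 2 ^ (k + 6) * card (ix y \<inter> {t (a y)..t (Suc (a y))})"
    by metis
  define P where "P i = {y\<in>F2. a y = i}" for i
  \<comment> \<open>The odd intervals are the gaps: there the point has to leave the shadow of the
    level-k piece owning the gap. The even intervals carry no constraint of their own.\<close>
  define Z where "Z i = (if odd i then - shadow (t (Suc i)) (st (e (i div 2))) else UNIV)" for i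
  have "\<exists>z. \<forall>i<Suc (2*s). z \<in> Z i \<and> (\<forall>x\<in>P i. z \<notin> st x)"
  proof (rule thread[OF te(1)])
    fix i assume "i < Suc (2*s)"
    show "cylinder (t (Suc i)) (Z i)"
      by (simp add: Z_def cylinder_UNIV cylinder_Compl cylinder_shadow)
  next
    fix i u assume i: "i < Suc (2*s)"
    have PF: "finite (P i)" "P i \<subseteq> C" using F2 by (auto simp: P_def)
    have mi: "t i \<le> t (Suc i)" using te(1) by (simp add: mono_def)
    have big: "card (ix x) \<le> 2 ^ (lv x + 5) * card (ix x \<inter> {t i..t (Suc i)})" if "x \<in> P i" for x
    proof -
      have "(2::nat) ^ (k + 6) \<le> 2 ^ (lv x + 5)"
        using C(2)[of x] PF(2) that by (intro power_increasing) auto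
      then show ?thesis
        using a(2)[of x] that unfolding P_def by (auto intro: order_trans mult_le_mono1)
    qed
    show "\<not> graft u (t i) -` Z i \<subseteq> (\<Union>x\<in>P i. graft u (t i) -` shadow (t (Suc i)) (st x))"
    proof (cases "odd i")
      case False
      show ?thesis
      proof
        assume "graft u (t i) -` Z i \<subseteq> (\<Union>x\<in>P i. graft u (t i) -` shadow (t (Suc i)) (st x))"
        then have *: "UNIV \<subseteq> (\<Union>x\<in>P i. graft u (t i) -` shadow (t (Suc i)) (st x))"
          using False by (simp add: Z_def)
        \<comment> \<open>Between gaps no constant can be wasted: the exact factor of level k+1 is
          used, matching \<open>bnd_step\<close>.\<close>
        have "cov C UNIV (bnd (Suc k))"
        proof (rule cov_localize[OF C(1) PF mi big _ _ *])
          fix x assume "x \<in> P i"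
          then have "k + 6 \<le> lv x + 5" using C(2)[of x] PF(2) by auto
          then show "2 powr (1 / real ((lv x + 5)^2)) \<le> (2::real) powr (1 / real ((k + 6)^2))"
            by (intro powr_mono divide_left_mono) (auto intro!: power_mono simp del: of_nat_power of_nat_add)
        next
          have "sum weight (P i) < bnd k"
            using sum_weight_mono[of F "P i"] F(1,4) F12 unfolding P_def
            by (metis (no_types, lifting) Un_iff mem_Collect_eq order_le_less_trans subsetI)
          then have "2 powr (1 / real ((k + 6)^2)) * sum weight (P i) < 2 powr (1 / real ((k + 6)^2)) * bnd k"
            by (intro mult_strict_left_mono) auto
          then show "2 powr (1 / real ((k + 6)^2)) * sum weight (P i) < bnd (Suc k)"
            using bnd_step[of k] by linarith
        qed
        then show False using nc by blast
      qed
    next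
      case True
      then obtain j where j: "i = 2*j+1" by (elim oddE)
      have js: "j < s" using i j by simp
      let ?x = "e j"
      have "?x \<in> F1" using te(4) js by blast
      then have "thin C (ix ?x) (st ?x)" using F1(2) by (auto simp: thin_pieces_def)
      then have nc1: "\<not> cov C (graft u (t i) -` Z i) 1"
        using gap[OF js] True j unfolding thin_def Z_def by simp
      show ?thesis
      proof
        assume *: "graft u (t i) -` Z i \<subseteq> (\<Union>x\<in>P i. graft u (t i) -` shadow (t (Suc i)) (st x))"
        \<comment> \<open>In a gap the crude factor 2 suffices, since the weight below 1/2 becomes
          one below 1, the threshold in \<open>thin\<close>.\<close>
        have "cov C (graft u (t i) -` Z i) 1"
        proof (rule cov_localize[OF C(1) PF mi big scale_le_2 _ *])
          have "sum weight (P i) \<le>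
             sum weight {y\<in>F2. card (ix y) \<le> 2 ^ (k + 6) * card (ix y \<inter> {t i..t (Suc i)})}"
            using F2(1) a(2) by (intro sum_weight_mono) (auto simp: P_def)
          also have "\<dots> < 1/2" using gap[OF js] j unfolding light_def by simp
          finally show "2 * sum weight (P i) < 1" by simp
        qed
        then show False using nc1 by blast
      qed
    qed
  qed
  then obtain z where z: "\<And>i. i < Suc (2*s) \<Longrightarrow> z \<in> Z i \<and> (\<forall>x\<in>P i. z \<notin> st x)" by blast
  obtain x where x: "x \<in> F" "z \<in> st x" using F(3) by blast
  show False
  proof (cases "x \<in> F1")
    case True
    then obtain j where j: "j < s" "x = e j" using te(4) by blast
    then have "z \<in> Z (2*j+1)" using z[of "2*j+1"] by simp
    then have "z \<notin> shadow (t (Suc (2*j+1))) (st x)" using j by (simp add: Z_def)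
    then show False using x(2) shadow_extensive by blast
  next
    case False
    then have "x \<in> F2" using x(1) F12 by blast
    then have "x \<in> P (a x)" by (simp add: P_def)
    then show False using z[OF a(1)[OF \<open>x \<in> F2\<close>]] x(2) by blast
  qed
qed

lemma lower_bound: "\<not> cov (approx k j) UNIV (bnd k)"
proof (induction k j rule: approx.induct)
  case (1 k)
  then show ?case by (auto simp: cov_def)
next
  case (2 k j)
  then show ?case
    using lower_bound_step[OF stable_approx, of "Suc k" j k] lv_approx[of _ "Suc k" j]
    by (simp add: Suc_le_eq)
qed

lemma lower_bound_16: "\<not> cov (approx k j) UNIV 16"
  using lower_bound cov_mono[OF _ order_refl order_refl bnd_ge] by blast

section \<open>The limit construction\<close>

text \<open>Zorn is applied to families all of whose finite subfamilies have infinite intersection.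
  Asking for infinite rather than nonempty intersections puts the sets {n..} into a maximal family
  and makes the ultrafilter free.\<close>

lemma free_ultrafilter_exists:
  "\<exists>U :: nat filter. U \<noteq> bot \<and> U \<le> sequentially \<and>
     (\<forall>P. eventually P U \<or> eventually (\<lambda>p. \<not> P p) U)"
proof -
  define A :: "nat set set set" where "A = {V. \<forall>W\<subseteq>V. finite W \<longrightarrow> infinite (\<Inter>W)}"
  have "\<exists>M\<in>A. \<forall>X\<in>A. M \<subseteq> X \<longrightarrow> X = M"
  proof (rule subset_Zorn_nonempty)
    have "{} \<in> A" by (simp add: A_def)
    then show "A \<noteq> {}" by blast
  next
    fix \<C> assume \<C>: "\<C> \<noteq> {}" "subset.chain A \<C>"
    have "infinite (\<Inter>W)" if W: "W \<subseteq> \<Union>\<C>" "finite W" for W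
    proof -
      obtain V where "V \<in> \<C>" "W \<subseteq> V"
        using finite_subset_Union_chain[OF W(2,1) \<C>] by blast
      then show ?thesis
        using \<C>(2) W(2) unfolding A_def subset_chain_def by blast
    qed
    then show "\<Union>\<C> \<in> A" by (simp add: A_def)
  qed
  then obtain M where M: "M \<in> A" "\<And>X. X \<in> A \<Longrightarrow> M \<subseteq> X \<Longrightarrow> X = M" by blast
  have MI: "infinite (\<Inter>W)" if "W \<subseteq> M" "finite W" for W
    using M(1) that by (simp add: A_def)
  have add: "S \<in> M" if S: "\<And>W. W \<subseteq> M \<Longrightarrow> finite W \<Longrightarrow> infinite (\<Inter>W \<inter> S)" for S
  proof -
    have "infinite (\<Inter>W)" if "W \<subseteq> insert S M" "finite W" for W
    proof -
      have "infinite (\<Inter>(W - {S}) \<inter> S)" using that by (intro S) auto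
      moreover have "\<Inter>(W - {S}) \<inter> S \<subseteq> \<Inter>W" by auto
      ultimately show ?thesis using finite_subset by blast
    qed
    then have "insert S M \<in> A" by (simp add: A_def)
    then show ?thesis using M(2)[of "insert S M"] by blast
  qed
  define U where "U = (INF S\<in>M. principal S)"
  have ev: "eventually (\<lambda>p. p \<in> S) U" if "S \<in> M" for S
    unfolding U_def using that by (rule eventually_INF1) (simp add: eventually_principal)
  have "U \<noteq> bot"
  proof
    assume "U = bot"
    then have "eventually (\<lambda>_. False) (INF S\<in>M. principal S)" by (simp add: U_def)
    then obtain W where W: "W \<subseteq> M" "finite W" "eventually (\<lambda>_. False) (INF S\<in>W. principal S)"
      unfolding eventually_INF[of _ _ M] by blast
    then have "\<Inter>W = {}"
      using INF_principal_finite[OF W(2), of "\<lambda>S. S"] by (auto simp: eventually_principal)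
    then show False using MI[OF W(1,2)] by simp
  qed
  moreover have "U \<le> sequentially"
    unfolding le_sequentially
  proof
    fix n
    have "{n..} \<in> M"
    proof (rule add)
      fix W assume "W \<subseteq> M" "finite W"
      then have "infinite (\<Inter>W)" by (rule MI)
      moreover have "\<Inter>W \<subseteq> (\<Inter>W \<inter> {n..}) \<union> {..<n}" by auto
      ultimately show "infinite (\<Inter>W \<inter> {n..})"
        using finite_subset by blast
    qed
    then show "eventually (\<lambda>p. n \<le> p) U" using ev by fastforce
  qed
  moreover have "eventually P U \<or> eventually (\<lambda>p. \<not> P p) U" for P
  proof (cases "{p. P p} \<in> M \<or> {p. \<not> P p} \<in> M")
    case True
    then show ?thesis using ev by fastforce
  next
    case False
    then obtain W1 W2 where W: "W1 \<subseteq> M" "finite W1" "finite (\<Inter>W1 \<inter> {p. P p})"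
        "W2 \<subseteq> M" "finite W2" "finite (\<Inter>W2 \<inter> {p. \<not> P p})"
      using add by meson
    have "\<Inter>(W1 \<union> W2) \<subseteq> (\<Inter>W1 \<inter> {p. P p}) \<union> (\<Inter>W2 \<inter> {p. \<not> P p})" by auto
    then have "finite (\<Inter>(W1 \<union> W2))" using W finite_subset by blast
    then show ?thesis using MI[of "W1 \<union> W2"] W by blast
  qed
  ultimately show ?thesis by blast
qed

definition ultra :: "nat filter" where
  "ultra = (SOME U. U \<noteq> bot \<and> U \<le> sequentially \<and>
     (\<forall>P. eventually P U \<or> eventually (\<lambda>p. \<not> P p) U))"

lemma ultra_nontrivial: "ultra \<noteq> bot"
  and ultra_sequentially: "ultra \<le> sequentially"
  and ultra: "eventually P ultra \<or> eventually (\<lambda>p. \<not> P p) ultra"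
  using someI_ex[OF free_ultrafilter_exists] unfolding ultra_def by blast+

lemma ultra_ge: "eventually (\<lambda>p. n \<le> p) ultra"
  using ultra_sequentially unfolding le_sequentially by blast

text \<open>The essential use of the ultrafilter property: a choice among finitely many candidates
  that varies with p can be frozen.\<close>

lemma ultra_finite_bex:
  assumes "finite S" "eventually (\<lambda>p. \<exists>G\<in>S. Q G p) ultra"
  shows "\<exists>G\<in>S. eventually (Q G) ultra"
proof (rule ccontr)
  assume "\<not> ?thesis"
  then have "\<forall>G\<in>S. eventually (\<lambda>p. \<not> Q G p) ultra" using ultra by blast
  then have "eventually (\<lambda>p. \<forall>G\<in>S. \<not> Q G p) ultra"
    using assms(1) by (simp add: eventually_ball_finite)
  with assms(2) have "eventually (\<lambda>p. False) ultra" by eventually_elim blast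
  then show False using ultra_nontrivial by (simp add: trivial_limit_def)
qed

text \<open>Here p is the level where the recursion starts, the same for all k, so that consecutive
  levels refer to one recursion. Values p \<le> k are discarded by \<open>ultra_ge\<close>.\<close>

definition limit :: "nat \<Rightarrow> piece set" where
  "limit k = {x. eventually (\<lambda>p. x \<in> approx k (p - k)) ultra}"

lemma limitD: "x \<in> limit k \<Longrightarrow> \<exists>p. x \<in> approx k (p - k)"
  unfolding limit_def using eventually_happens ultra_nontrivial by fastforce

lemma stable_limit: "stable (limit k)"
  unfolding stable_def
proof (intro ballI conjI allI impI)
  fix x assume x: "x \<in> limit k"
  obtain p where p: "x \<in> approx k (p - k)" using limitD[OF x] by blast
  show "finite (ix x)" "ix x \<noteq> {}" "card (ix x) \<le> N (lv x)"
    by (rule stableD[OF stable_approx p])+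
  fix u m n J assume J: "m \<le> n" "J \<noteq> {}" "J \<subseteq> ix x \<inter> {m..n}"
  have "eventually (\<lambda>p. x \<in> approx k (p - k)) ultra" using x by (simp add: limit_def)
  then have "eventually (\<lambda>p. (lv x, J, graft u m -` shadow n (st x)) \<in> approx k (p - k)) ultra"
    by (rule eventually_mono) (rule stableD(5)[OF stable_approx _ J])
  then show "(lv x, J, graft u m -` shadow n (st x)) \<in> limit k" by (simp add: limit_def)
qed

lemma approx_diff: "k < p \<Longrightarrow> approx k (p - k) =
    approx (Suc k) (p - Suc k) \<union> thin_pieces k (approx (Suc k) (p - Suc k))"
  by (metis Suc_diff_Suc approx.simps(2))

lemma limit_Suc_subset: "limit (Suc k) \<subseteq> limit k"
proof
  fix x assume "x \<in> limit (Suc k)"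
  then have "eventually (\<lambda>p. x \<in> approx (Suc k) (p - Suc k)) ultra" by (simp add: limit_def)
  then have "eventually (\<lambda>p. x \<in> approx k (p - k)) ultra"
    using ultra_ge[of "Suc k"] by eventually_elim (simp add: approx_diff)
  then show "x \<in> limit k" by (simp add: limit_def)
qed

lemma limit_subset: "limit k \<subseteq> limit 0"
  using limit_Suc_subset by (induction k) auto

lemma limitI:
  assumes "finite I" "I \<noteq> {}" "card I \<le> N k"
    and "eventually (\<lambda>p. thin (approx (Suc k) (p - Suc k)) I X) ultra"
  shows "(k, I, X) \<in> limit k"
proof -
  have "eventually (\<lambda>p. (k, I, X) \<in> approx k (p - k)) ultra"
    using assms(4) ultra_ge[of "Suc k"]
    by eventually_elim (use assms(1-3) in \<open>simp add: approx_diff thin_pieces_def\<close>)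
  then show ?thesis by (simp add: limit_def)
qed

text \<open>Covers are finite, so one taken from the limit lies entirely in a single
  approximation.\<close>

lemma lower_bound_limit: "\<not> cov (limit k) UNIV 16"
proof
  assume "cov (limit k) UNIV 16"
  then obtain F where F: "finite F" "F \<subseteq> limit k" "UNIV \<subseteq> \<Union>(st ` F)" "sum weight F < 16"
    unfolding cov_def by blast
  then have "eventually (\<lambda>p. \<forall>x\<in>F. x \<in> approx k (p - k)) ultra"
    by (intro eventually_ball_finite) (auto simp: limit_def)
  then obtain p where "\<forall>x\<in>F. x \<in> approx k (p - k)"
    using eventually_happens ultra_nontrivial by fastforce
  then have "cov (approx k (p - k)) UNIV 16" unfolding cov_def using F by blast
  then show False using lower_bound_16 by blast
qed

section \<open>Reducing covers of a set to its rank\<close>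

definition half :: "nat \<Rightarrow> piece \<Rightarrow> bool" where
  "half r x \<longleftrightarrow> card (ix x) \<le> 2 * card (ix x \<inter> {0..r})"

lemma half_mono: "half r x \<Longrightarrow> r \<le> r' \<Longrightarrow> half r' x"
  unfolding half_def by (rule order_trans) (auto intro!: card_mono)

lemma half_scaled: "c \<le> 2 * d \<Longrightarrow> c \<le> 2 ^ (l + 5) * (d::nat)"
proof -
  assume "c \<le> 2 * d"
  also have "2 * d \<le> 2 ^ (l + 5) * d"
    using power_increasing[of 1 "l + 5" "2::nat"] by (intro mult_le_mono1) simp
  finally show ?thesis .
qed

lemma not_half:
  assumes "\<not> half r x" "ix x \<subseteq> {0..M}"
  shows "card (ix x) \<le> 2 * card (ix x \<inter> {r..M})"
proof -
  have "card (ix x) \<le> card (ix x \<inter> {0..r} \<union> ix x \<inter> {r..M})"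
    using assms(2) by (intro card_mono) auto
  also have "\<dots> \<le> card (ix x \<inter> {0..r}) + card (ix x \<inter> {r..M})" by (rule card_Un_le)
  finally show ?thesis using assms(1) by (simp add: half_def)
qed

lemma stable_bounded:
  assumes "stable C" "finite F" "F \<subseteq> C"
  shows "\<exists>M. m \<le> M \<and> (\<forall>x\<in>F. ix x \<subseteq> {0..M})"
proof -
  have "finite (\<Union>x\<in>F. ix x)" using assms stableD(1)[OF assms(1)] by auto
  then have "(\<Union>x\<in>F. ix x) \<subseteq> {0..Max (insert m (\<Union>x\<in>F. ix x))}"
    by (simp add: subset_iff)
  then have "\<forall>x\<in>F. ix x \<subseteq> {0..Max (insert m (\<Union>x\<in>F. ix x))}"
    by blast
  moreover have "m \<le> Max (insert m (\<Union>x\<in>F. ix x))"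
    using \<open>finite (\<Union>x\<in>F. ix x)\<close> by simp
  ultimately show ?thesis by blast
qed

text \<open>Otherwise the pieces whose index set lies mostly beyond \<open>r\<close> would cover an atom of rank \<open>r\<close>,
  and after rescaling this atom they would cover the whole space too cheaply.\<close>

lemma drop_far:
  assumes C: "stable C" "\<not> cov C UNIV 16" and F: "finite F" "F \<subseteq> C" "sum weight F < 8"
    and B: "cylinder r B" "B \<subseteq> \<Union>(st ` F)"
  shows "B \<subseteq> (\<Union>x\<in>{x\<in>F. half r x}. shadow r (st x))"
proof (rule ccontr)
  assume "\<not> ?thesis"
  then obtain z where z: "z \<in> B" "\<And>x. x \<in> F \<Longrightarrow> half r x \<Longrightarrow> z \<notin> shadow r (st x)" by blast
  obtain M where M: "r \<le> M" "\<forall>x\<in>F. ix x \<subseteq> {0..M}" using stable_bounded[OF C(1) F(1,2)] by blast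
  define F2 where "F2 = {x\<in>F. \<not> half r x}"
  have F2: "finite F2" "F2 \<subseteq> C" "F2 \<subseteq> F" using F by (auto simp: F2_def)
  have "y \<in> (\<Union>x\<in>F2. graft z r -` shadow M (st x))" for y
  proof -
    have ag: "agree r (graft z r y) z" by (rule agree_graft)
    then have "graft z r y \<in> B" using cylinderD[OF B(1) ag] z(1) by blast
    then obtain x where x: "x \<in> F" "graft z r y \<in> st x" using B(2) by blast
    then have "z \<in> shadow r (st x)" using ag unfolding shadow_def by blast
    then have "x \<in> F2" using z(2)[of x] x(1) unfolding F2_def by blast
    then show ?thesis using x(2) shadow_extensive by blast
  qed
  then have "UNIV \<subseteq> (\<Union>x\<in>F2. graft z r -` shadow M (st x))" by blast
  moreover have "2 * sum weight F2 < 16"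
    using sum_weight_mono[OF F(1) F2(3)] F(3) by linarith
  ultimately have "cov C UNIV 16"
    using M(2) F2 not_half by (intro cov_localize[OF C(1) F2(1,2) M(1) half_scaled scale_le_2]) (auto simp: F2_def)
  then show False using C(2) by blast
qed

definition rank_pieces :: "nat \<Rightarrow> piece set" where
  "rank_pieces r = {x. lv x \<le> r \<and> ix x \<subseteq> {0..r} \<and> cylinder r (st x)}"

lemma finite_rank_pieces: "finite (rank_pieces r)"
proof (rule finite_subset)
  show "rank_pieces r \<subseteq> {0..r} \<times> Pow {0..r} \<times> {X. cylinder r X}"
    unfolding rank_pieces_def by auto
  show "finite ({0..r} \<times> Pow {0..r} \<times> {X. cylinder r X})"
    by (intro finite_cartesian_product finite_cylinders) auto
qed

lemma vimage_graft_0 [simp]: "graft u 0 -` X = X"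
  by (auto simp: vimage_def)

text \<open>The new cover comes from the finite family \<open>rank_pieces r\<close>, the same for
  every class C. Pieces living mostly beyond r are dropped by \<open>drop_far\<close>, the others
  are cut back to rank r at the cost of a factor 2. Their level is at most r since a cheap piece of
  level l needs 2^(2l+20) indices.\<close>

lemma cov_reduce:
  assumes C: "stable C" "\<not> cov C UNIV 16" and B: "cylinder r B" "cov C B t" "t \<le> 8"
  shows "\<exists>G. G \<subseteq> C \<inter> rank_pieces r \<and> B \<subseteq> \<Union>(st ` G) \<and> sum weight G < 2 * t"
proof -
  obtain F where F: "finite F" "F \<subseteq> C" "B \<subseteq> \<Union>(st ` F)" "sum weight F < t"
    using B(2) unfolding cov_def by blast
  define F1 where "F1 = {x\<in>F. half r x}"
  have F1: "finite F1" "F1 \<subseteq> C" "F1 \<subseteq> F" using F by (auto simp: F1_def)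
  have big: "card (ix x) \<le> 2 ^ (lv x + 5) * card (ix x \<inter> {0..r})" if "x \<in> F1" for x
    using that half_scaled by (auto simp: F1_def half_def)
  \<comment> \<open>With m = 0 nothing is grafted, so the value \<open>undefined\<close> has no
    influence; this only coarsens the pieces to rank r and restricts their indices to
    {0..r}.\<close>
  define G where "G = (\<lambda>x. (lv x, ix x \<inter> {0..r}, graft undefined 0 -` shadow r (st x))) ` F1"
  note G = localize[OF C(1) F1(1,2) le0 big scale_le_2, where u = undefined, folded G_def]
  have sum: "sum weight G < 2 * t"
    using G(3) sum_weight_mono[OF F(1) F1(3)] F(4) by linarith
  have "lv y \<le> r" if "y \<in> G" for y
  proof -
    have "weight y < 32"
      using sum_weight_mono[OF G(1), of "{y}"] that sum B(3) by simp
    then have "2 ^ (2 * lv y + 20) \<le> card (ix y)"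
      using weight_small[OF C(1)] G(2) that by blast
    also have "card (ix y) \<le> card {0..r}"
      using that unfolding G_def by (intro card_mono) auto
    finally have "2 * lv y + 20 < Suc r"
      using less_exp[of "2 * lv y + 20"] by (simp only: card_atLeastAtMost diff_zero)
    then show ?thesis by simp
  qed
  then have "G \<subseteq> C \<inter> rank_pieces r"
    using G(2) by (auto simp: rank_pieces_def G_def cylinder_shadow)
  moreover have "B \<subseteq> \<Union>(st ` G)"
    using drop_far[OF C F(1,2) _ B(1) F(3)] F(4) B(3) G(4) by (simp add: F1_def)
  ultimately show ?thesis using sum by blast
qed

text \<open>Otherwise covers of weight below 1 exist for almost all p. \<open>cov_reduce\<close>
  moves them into a fixed finite family, where one cover serves almost all p and hence lies in the
  limit; the reduction turns 1 into 2.\<close>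

lemma limit_not_cov:
  assumes "cylinder r B" "\<not> cov (limit k) B 2"
  shows "eventually (\<lambda>p. \<not> cov (approx k (p - k)) B 1) ultra"
proof (rule ccontr)
  assume "\<not> ?thesis"
  then have "eventually (\<lambda>p. cov (approx k (p - k)) B 1) ultra"
    using ultra[of "\<lambda>p. cov (approx k (p - k)) B 1"] by blast
  then have "eventually (\<lambda>p. \<exists>G\<in>Pow (rank_pieces r). G \<subseteq> approx k (p - k) \<and>
      B \<subseteq> \<Union>(st ` G) \<and> sum weight G < 2) ultra"
  proof (rule eventually_mono)
    fix p assume "cov (approx k (p - k)) B 1"
    from cov_reduce[OF stable_approx lower_bound_16 assms(1) this]
    show "\<exists>G\<in>Pow (rank_pieces r). G \<subseteq> approx k (p - k) \<and> B \<subseteq> \<Union>(st ` G) \<and> sum weight G < 2"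
      by auto
  qed
  from ultra_finite_bex[OF _ this] obtain G where G: "G \<subseteq> rank_pieces r"
    "eventually (\<lambda>p. G \<subseteq> approx k (p - k) \<and> B \<subseteq> \<Union>(st ` G) \<and> sum weight G < 2) ultra"
    using finite_rank_pieces by blast
  have "x \<in> limit k" if "x \<in> G" for x
    unfolding limit_def using G(2) that by (auto elim: eventually_mono)
  moreover have "B \<subseteq> \<Union>(st ` G) \<and> sum weight G < 2"
    using eventually_happens[OF G(2)] ultra_nontrivial by blast
  ultimately have "cov (limit k) B 2"
    unfolding cov_def using finite_subset[OF G(1) finite_rank_pieces] by (metis subsetI)
  then show False using assms(2) by blast
qed

section \<open>Exhaustivity\<close>

text \<open>The pieces living mostly below m cannot cover the space, so some u avoids their shadows.
  B does not change when u is grafted, and along u only the remaining pieces matter.\<close>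

lemma cov_restrict:
  assumes C: "stable C" "\<not> cov C UNIV 16" and inv: "\<And>u. graft u m -` B = B"
    and B: "cov C B t" "t \<le> 8"
  shows "\<exists>G. finite G \<and> G \<subseteq> C \<and> B \<subseteq> \<Union>(st ` G) \<and> sum weight G < 2 * t \<and> (\<forall>x\<in>G. ix x \<subseteq> {m..})"
proof -
  obtain F where F: "finite F" "F \<subseteq> C" "B \<subseteq> \<Union>(st ` F)" "sum weight F < t"
    using B(1) unfolding cov_def by blast
  obtain M where M: "m \<le> M" "\<forall>x\<in>F. ix x \<subseteq> {0..M}" using stable_bounded[OF C(1) F(1,2)] by blast
  define F1 where "F1 = {x\<in>F. half m x}"
  define F2 where "F2 = {x\<in>F. \<not> half m x}"
  have F1: "finite F1" "F1 \<subseteq> C" "F1 \<subseteq> F" and F2: "finite F2" "F2 \<subseteq> C" "F2 \<subseteq> F"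
    using F by (auto simp: F1_def F2_def)
  have big1: "card (ix x) \<le> 2 ^ (lv x + 5) * card (ix x \<inter> {0..m})" if "x \<in> F1" for x
    using that half_scaled by (auto simp: F1_def half_def)
  have big2: "card (ix x) \<le> 2 ^ (lv x + 5) * card (ix x \<inter> {m..M})" if "x \<in> F2" for x
    using that half_scaled[OF not_half] M(2) F2(3) by (auto simp: F2_def)
  have "\<not> UNIV \<subseteq> (\<Union>x\<in>F1. graft undefined 0 -` shadow m (st x))"
  proof
    assume *: "UNIV \<subseteq> (\<Union>x\<in>F1. graft undefined 0 -` shadow m (st x))"
    have "2 * sum weight F1 < 16" using sum_weight_mono[OF F(1) F1(3)] F(4) B(2) by linarith
    then have "cov C UNIV 16"
      by (intro cov_localize[OF C(1) F1(1,2) le0 big1 scale_le_2 _ *])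
    then show False using C(2) by blast
  qed
  then obtain u where u: "\<And>x. x \<in> F1 \<Longrightarrow> u \<notin> shadow m (st x)" by auto
  define G where "G = (\<lambda>x. (lv x, ix x \<inter> {m..M}, graft u m -` shadow M (st x))) ` F2"
  note G = localize[OF C(1) F2(1,2) M(1) big2 scale_le_2, where u = u, folded G_def]
  have "B \<subseteq> (\<Union>x\<in>F2. graft u m -` shadow M (st x))"
  proof
    fix z assume "z \<in> B"
    then have "graft u m z \<in> B" using inv[of u] by blast
    then obtain x where x: "x \<in> F" "graft u m z \<in> st x" using F(3) by blast
    then have "u \<in> shadow m (st x)" using agree_graft unfolding shadow_def by blast
    then have "x \<in> F2" using x(1) u[of x] unfolding F1_def F2_def by blast
    then show "z \<in> (\<Union>x\<in>F2. graft u m -` shadow M (st x))"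
      using x(2) shadow_extensive by blast
  qed
  then have "B \<subseteq> \<Union>(st ` G)" by (simp only: G(4))
  moreover have "sum weight G < 2 * t"
    using G(3) sum_weight_mono[OF F(1) F2(3)] F(4) by linarith
  moreover have "\<forall>x\<in>G. ix x \<subseteq> {m..}" by (auto simp: G_def)
  ultimately show ?thesis using G(1,2) by blast
qed

text \<open>The rank \<open>r\<close> is chosen so that the total weight of the pieces supported mostly below \<open>r\<close> is
  almost as large as it can be for infinitely many \<open>i\<close>; then the pieces supported mostly between
  \<open>r\<close> and a larger rank have small total weight.\<close>

lemma absorb:
  assumes C: "stable C" "\<not> cov C UNIV 16" and "0 < \<epsilon>"
    and B: "incseq B" "\<And>i. \<exists>r. cylinder r (B i)"
    and F: "\<And>i. finite (F i)" "\<And>i. F i \<subseteq> C" "\<And>i. B i \<subseteq> \<Union>(st ` F i)" "\<And>i. sum weight (F i) < 4"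
      "\<And>i x. x \<in> F i \<Longrightarrow> ix x \<subseteq> {m..}"
  shows "\<exists>D r. cylinder r D \<and> (\<forall>u. cov C (graft u m -` D) 8) \<and> (\<forall>i. cov C (B i - D) \<epsilon>)"
proof -
  define W where "W i r = sum weight {x\<in>F i. half r x}" for i r
  have fin: "finite {x\<in>F i. half r x}" for i r using F(1) by simp
  have W4: "W i r < 4" for i r
    unfolding W_def using F(4)[of i] sum_weight_mono[OF F(1)[of i], of "{x\<in>F i. half r x}"] by auto
  have Wmono: "W i r \<le> W i r'" if "r \<le> r'" for i r r'
    unfolding W_def using half_mono[OF _ that] by (intro sum_weight_mono fin) auto
  define S where "S = {w. \<exists>r. infinite {i. w \<le> W i r}}"
  have "0 \<in> S" unfolding S_def W_def by (simp add: sum_weight_nonneg)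
  have S4: "w \<le> 4" if w: "w \<in> S" for w
  proof -
    obtain r where "infinite {i. w \<le> W i r}" using w unfolding S_def by blast
    then obtain i where "w \<le> W i r" using not_finite_existsD by blast
    then show ?thesis using W4[of i r] by linarith
  qed
  have bdd: "bdd_above S" using S4 by (rule bdd_aboveI)
  define s where "s = Sup S"
  \<comment> \<open>The pieces left over below will weigh less than 2\<delta>, and localizing them
    doubles this.\<close>
  define \<delta> where "\<delta> = \<epsilon> / 4"
  have "\<delta> > 0" using \<open>0 < \<epsilon>\<close> by (simp add: \<delta>_def)
  obtain w where w: "w \<in> S" "s - \<delta> < w"
    using less_cSup_iff[OF _ bdd, of "s - \<delta>"] \<open>0 \<in> S\<close> \<open>\<delta> > 0\<close> unfolding s_def by auto
  obtain r0 where r0: "infinite {i. w \<le> W i r0}" using w(1) unfolding S_def by blast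
  define r where "r = max m r0"
  have "{i. w \<le> W i r0} \<subseteq> {i. s - \<delta> < W i r}"
  proof
    fix i assume "i \<in> {i. w \<le> W i r0}"
    moreover have "W i r0 \<le> W i r" by (rule Wmono) (simp add: r_def)
    ultimately show "i \<in> {i. s - \<delta> < W i r}" using w(2) by simp
  qed
  then have infA: "infinite {i. s - \<delta> < W i r}" using r0 finite_subset by blast
  define K where "K i = (\<Union>x\<in>{x\<in>F i. half r x}. shadow r (st x))" for i
  have cylK: "cylinder r (K i)" for i
    unfolding K_def by (intro cylinder_UN cylinder_shadow) simp
  \<comment> \<open>All \<open>K i\<close> have rank r, so a single one of them, taken as D, occurs
    for infinitely many of the good i.\<close>
  have "finite (K ` {i. s - \<delta> < W i r})"
    by (rule finite_subset[OF _ finite_cylinders[of r]]) (use cylK in auto)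
  then obtain i1 where i1: "infinite {i \<in> {i. s - \<delta> < W i r}. K i = K i1}"
    using pigeonhole_infinite[OF infA] by blast
  define D where "D = K i1"
  have "cov C (graft u m -` D) 8" for u
  proof (rule cov_localize[OF C(1) fin[of i1 r]])
    show "{x\<in>F i1. half r x} \<subseteq> C" using F(2) by blast
    show "m \<le> r" by (simp add: r_def)
    show "card (ix x) \<le> 2 ^ (lv x + 5) * card (ix x \<inter> {m..r})" if "x \<in> {x\<in>F i1. half r x}" for x
    proof -
      have "ix x \<inter> {0..r} = ix x \<inter> {m..r}" using F(5)[of x i1] that by auto
      then show ?thesis using that half_scaled by (auto simp: half_def)
    qed
    show "2 * sum weight {x\<in>F i1. half r x} < 8" using W4[of i1 r] by (simp add: W_def)
    show "graft u m -` D \<subseteq> (\<Union>x\<in>{x\<in>F i1. half r x}. graft u m -` shadow r (st x))"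
      by (auto simp: D_def K_def)
  qed (rule scale_le_2)
  moreover have "cov C (B i - D) \<epsilon>" for i
  proof -
    obtain r1 where r1: "cylinder r1 (B i)" using B(2) by blast
    define r' where "r' = max r r1"
    have r': "cylinder r' (B i)" "r \<le> r'" using cylinder_mono[OF r1] by (auto simp: r'_def)
    have "s + \<delta> \<notin> S" using cSup_upper[OF _ bdd] \<open>\<delta> > 0\<close> unfolding s_def by fastforce
    then have "finite {j. s + \<delta> \<le> W j r'}" by (auto simp: S_def)
    then have "finite ({j. s + \<delta> \<le> W j r'} \<union> {..<i})" by simp
    \<comment> \<open>Only finitely many j reach s + \<delta> at rank r', so some j \<ge> i with
      \<open>K j = D\<close> stays below. Its cover also serves \<open>B i\<close> because B
      increases.\<close>
    then obtain j where j: "s - \<delta> < W j r" "K j = D" "W j r' < s + \<delta>" "i \<le> j"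
      using i1 finite_subset[of "{i \<in> {i. s - \<delta> < W i r}. K i = K i1}" "{j. s + \<delta> \<le> W j r'} \<union> {..<i}"]
      unfolding D_def by fastforce
    have "B i \<subseteq> \<Union>(st ` F j)" using B(1) j(4) F(3)[of j] by (meson incseqD order_trans)
    then have Bi: "B i \<subseteq> (\<Union>x\<in>{x\<in>F j. half r' x}. shadow r' (st x))"
      using F(4)[of j] by (intro drop_far[OF C F(1,2) _ r'(1)]) auto
    define Q where "Q = {x\<in>F j. half r' x} - {x\<in>F j. half r x}"
    have Q: "finite Q" "Q \<subseteq> C" using F(1,2) by (auto simp: Q_def)
    have "{x\<in>F j. half r x} \<subseteq> {x\<in>F j. half r' x}" using half_mono[OF _ r'(2)] by blast
    then have "sum weight Q = W j r' - W j r"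
      unfolding Q_def W_def using fin by (intro sum_diff)
    then have "2 * sum weight Q < \<epsilon>" using j by (simp add: \<delta>_def)
    moreover have "B i - D \<subseteq> (\<Union>x\<in>Q. graft undefined 0 -` shadow r' (st x))"
    proof
      fix z assume z: "z \<in> B i - D"
      then obtain x where x: "x \<in> F j" "half r' x" "z \<in> shadow r' (st x)" using Bi by blast
      have "\<not> half r x"
      proof
        assume "half r x"
        then have "z \<in> K j" using x shadow_antimono[OF r'(2)] unfolding K_def by blast
        then show False using j(2) z by blast
      qed
      then show "z \<in> (\<Union>x\<in>Q. graft undefined 0 -` shadow r' (st x))"
        using x by (auto simp: Q_def)
    qed
    moreover have "card (ix x) \<le> 2 ^ (lv x + 5) * card (ix x \<inter> {0..r'})" if "x \<in> Q" for x
      using that half_scaled by (auto simp: Q_def half_def)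
    ultimately show ?thesis
      using cov_localize[OF C(1) Q le0 _ scale_le_2] by blast
  qed
  ultimately show ?thesis using cylK unfolding D_def by blast
qed

text \<open>If finitely many E j have a large union in the section at u, this union is D and all
  later E i miss it. Otherwise \<open>absorb\<close> gathers almost all of the sets in a set of
  submeasure below 8, and its complement is large because 2 + 8 < 16.\<close>

lemma exhaust_step:
  fixes E :: "nat \<Rightarrow> (nat \<Rightarrow> nat) set"
  assumes C: "stable C" "\<not> cov C UNIV 16" and "0 < \<epsilon>"
    and E: "\<And>i. \<exists>r. cylinder r (E i)" "\<And>i j. i < j \<Longrightarrow> E i \<inter> E j = {}"
  shows "\<exists>n D i0. cylinder n D \<and> \<not> cov C (graft u m -` D) 2 \<and>
    (\<forall>i\<ge>i0. cov C (E i \<inter> D \<inter> {z. agree m u z}) \<epsilon>)"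
proof (cases "\<exists>i0. \<not> cov C (\<Union>j<i0. graft u m -` E j) 2")
  case True
  then obtain i0 :: nat where i0: "\<not> cov C (\<Union>j<i0. graft u m -` E j) 2" by blast
  obtain rk where rk: "\<And>i. cylinder (rk i) (E i)" using E(1) by metis
  have "cylinder (sum rk {..<i0}) (\<Union>j<i0. E j)"
    by (rule cylinder_UN, rule cylinder_mono[OF rk], rule member_le_sum) auto
  moreover have "graft u m -` (\<Union>j<i0. E j) = (\<Union>j<i0. graft u m -` E j)" by blast
  moreover have "cov C (E i \<inter> (\<Union>j<i0. E j) \<inter> {z. agree m u z}) \<epsilon>" if "i0 \<le> i" for i
  proof -
    have "E j \<inter> E i = {}" if "j < i0" for j using E(2)[of j i] that \<open>i0 \<le> i\<close> by simp
    then have "E i \<inter> (\<Union>j<i0. E j) \<inter> {z. agree m u z} = {}" by blast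
    then show ?thesis using cov_empty[OF \<open>0 < \<epsilon>\<close>] by simp
  qed
  ultimately show ?thesis using i0 by metis
next
  case False
  define B where "B i = (\<Union>j<Suc i. graft u m -` E j)" for i
  obtain rk where rk: "\<And>i. cylinder (rk i) (E i)" using E(1) by metis
  have "cylinder (sum rk {..<Suc i}) (B i)" for i
    unfolding B_def
    by (rule cylinder_UN, rule cylinder_vimage_graft, rule cylinder_mono[OF rk], rule member_le_sum) auto
  then have cyl: "\<exists>r. cylinder r (B i)" for i by blast
  have "graft v m -` B i = B i" for v i
    unfolding B_def by (auto simp: graft_graft_inner)
  moreover have "cov C (B i) 2" for i using False unfolding B_def by blast
  ultimately have "\<exists>G. finite G \<and> G \<subseteq> C \<and> B i \<subseteq> \<Union>(st ` G) \<and> sum weight G < 4 \<and> (\<forall>x\<in>G. ix x \<subseteq> {m..})" for i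
    using cov_restrict[OF C, of m "B i" 2] by simp
  then obtain F where F: "\<And>i. finite (F i)" "\<And>i. F i \<subseteq> C" "\<And>i. B i \<subseteq> \<Union>(st ` F i)"
      "\<And>i. sum weight (F i) < 4" "\<And>i x. x \<in> F i \<Longrightarrow> ix x \<subseteq> {m..}"
    by metis
  have "incseq B" unfolding incseq_def B_def by (auto intro: order_less_le_trans)
  then have "\<exists>D r. cylinder r D \<and> (\<forall>u. cov C (graft u m -` D) 8) \<and> (\<forall>i. cov C (B i - D) \<epsilon>)"
    by (rule absorb[where F = F, OF C \<open>0 < \<epsilon>\<close> _ cyl]) (use F in auto)
  then obtain D r where D: "cylinder r D" "\<And>u. cov C (graft u m -` D) 8" "\<And>i. cov C (B i - D) \<epsilon>"
    by blast
  have "\<not> cov C (graft u m -` (- D)) 2"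
  proof
    assume "cov C (graft u m -` (- D)) 2"
    then have "cov C (graft u m -` (- D) \<union> graft u m -` D) (2 + 8)" using D(2) by (rule cov_Un)
    then have "cov C UNIV 16" by (rule cov_mono) auto
    then show False using C(2) by blast
  qed
  moreover have "cov C (E i \<inter> - D \<inter> {z. agree m u z}) \<epsilon>" for i
  proof (rule cov_mono[OF D(3)[of i] order_refl _ order_refl], rule)
    fix z assume z: "z \<in> E i \<inter> - D \<inter> {z. agree m u z}"
    then have "agree (rk i) (graft u m z) z" by (simp add: agree_graft_same)
    then have "graft u m z \<in> E i" using cylinderD[OF rk] z by blast
    then show "z \<in> B i - D" using z by (auto simp: B_def)
  qed
  ultimately show ?thesis using cylinder_Compl[OF D(1)] by blast
qed

lemma exhaustive_level:
  fixes E :: "nat \<Rightarrow> (nat \<Rightarrow> nat) set"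
  assumes "0 < \<epsilon>" and E: "\<And>i. \<exists>r. cylinder r (E i)" "\<And>i j. i < j \<Longrightarrow> E i \<inter> E j = {}"
  shows "\<exists>i. cov (limit k) (E i) (2 powr (- real k) + \<epsilon>)"
proof -
  define C where "C = limit (Suc k)"
  have C: "stable C" "\<not> cov C UNIV 16" "C \<subseteq> limit k"
    unfolding C_def by (simp_all add: stable_limit lower_bound_limit limit_Suc_subset)
  define L where "L = N k"
  have "0 < L" by (simp add: L_def N_def)
  have reps: "0 < card (reps m)" for m
    using rep_exists[of m undefined] finite_reps card_gt_0_iff by blast
  \<comment> \<open>An equal share of the error for each atom of rank m and each of the L ranks to
    be used; the shares add up to a quarter of \<epsilon>.\<close>
  define \<eta> where "\<eta> m = \<epsilon> / (4 * real L * real (card (reps m)))" for m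
  have \<eta>: "0 < \<eta> m" for m using \<open>0 < \<epsilon>\<close> \<open>0 < L\<close> reps by (simp add: \<eta>_def)
  have "\<exists>n i0 D. m < n \<and> (\<forall>u\<in>reps m. cylinder n (D u) \<and> \<not> cov C (graft u m -` D u) 2 \<and>
     (\<forall>i\<ge>i0. cov C (E i \<inter> D u \<inter> {z. agree m u z}) (\<eta> m)))" for m
  proof -
    have "\<exists>n D i0. cylinder n D \<and> \<not> cov C (graft u m -` D) 2 \<and>
        (\<forall>i\<ge>i0. cov C (E i \<inter> D \<inter> {z. agree m u z}) (\<eta> m))" for u
      by (rule exhaust_step[OF C(1,2) \<eta> E(1)]) (use E(2) in auto)
    then obtain n D i0 where *: "\<And>u. cylinder (n u) (D u)" "\<And>u. \<not> cov C (graft u m -` D u) 2"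
        "\<And>u i. i0 u \<le> i \<Longrightarrow> cov C (E i \<inter> D u \<inter> {z. agree m u z}) (\<eta> m)"
      by metis
    have le: "n u \<le> sum n (reps m)" "i0 u \<le> sum i0 (reps m)" if "u \<in> reps m" for u
      using that finite_reps by (auto intro: member_le_sum)
    show ?thesis
    proof (intro exI conjI ballI allI impI)
      show "m < Suc m + sum n (reps m)" by simp
    next
      fix u assume u: "u \<in> reps m"
      show "cylinder (Suc m + sum n (reps m)) (D u)"
        using cylinder_mono[OF *(1)] le(1)[OF u] by (simp add: le_SucI trans_le_add2)
      show "\<not> cov C (graft u m -` D u) 2" by (rule *(2))
      show "cov C (E i \<inter> D u \<inter> {z. agree m u z}) (\<eta> m)" if "sum i0 (reps m) \<le> i" for i
        using *(3)[of u i] le(2)[OF u] that by simp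
    qed
  qed
  then obtain nx i0 D where nx: "\<And>m. m < nx m"
    and D: "\<And>m u. u \<in> reps m \<Longrightarrow> cylinder (nx m) (D m u)"
      "\<And>m u. u \<in> reps m \<Longrightarrow> \<not> cov C (graft u m -` D m u) 2"
      "\<And>m u i. u \<in> reps m \<Longrightarrow> i0 m \<le> i \<Longrightarrow> cov C (E i \<inter> D m u \<inter> {z. agree m u z}) (\<eta> m)"
    by metis
  define ms where "ms j = (nx ^^ j) 0" for j
  have ms_Suc: "ms (Suc j) = nx (ms j)" for j by (simp add: ms_def)
  have "strict_mono ms" unfolding strict_mono_Suc_iff ms_Suc using nx by simp
  define I where "I = ms ` {..<L}"
  have I: "finite I" "I \<noteq> {}" "card I = L"
    using \<open>0 < L\<close> card_image[of ms "{..<L}"] strict_mono_imp_inj_on[OF \<open>strict_mono ms\<close>]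
    by (auto simp: I_def inj_on_subset)
  \<comment> \<open>The ranks and the sets D are fixed before i is chosen, so one i can exceed all L
    thresholds.\<close>
  define i where "i = (\<Sum>j<L. i0 (ms j))"
  define J where "J = (SIGMA j:{..<L}. reps (ms j))"
  have finJ: "finite J" unfolding J_def using finite_reps by auto
  define H where "H a = D (ms (fst a)) (snd a) \<inter> {z. agree (ms (fst a)) (snd a) z}" for a
  define X where "X = E i - (\<Union>a\<in>J. H a)"
  have Hcyl: "cylinder (nx (ms (fst a))) (H a)" if "a \<in> J" for a
    unfolding H_def using that D(1) cylinder_mono[OF cylinder_agree] nx
    by (intro cylinder_Int) (auto simp: J_def less_imp_le)
  \<comment> \<open>Thinness has to hold in the approximations, not merely for the limit class. As J
    is finite, almost all p serve all atoms at once.\<close>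
  have "eventually (\<lambda>p. \<forall>a\<in>J. \<not> cov (approx (Suc k) (p - Suc k)) (graft (snd a) (ms (fst a)) -` D (ms (fst a)) (snd a)) 1) ultra"
    using finJ
  proof (rule eventually_ball_finite, intro ballI)
    fix a assume "a \<in> J"
    then have a: "snd a \<in> reps (ms (fst a))" by (auto simp: J_def)
    show "eventually (\<lambda>p. \<not> cov (approx (Suc k) (p - Suc k)) (graft (snd a) (ms (fst a)) -` D (ms (fst a)) (snd a)) 1) ultra"
      using limit_not_cov[OF cylinder_vimage_graft[OF D(1)[OF a]]] D(2)[OF a] unfolding C_def by blast
  qed
  then have "eventually (\<lambda>p. thin (approx (Suc k) (p - Suc k)) I X) ultra"
  proof (rule eventually_mono)
    fix p assume p: "\<forall>a\<in>J. \<not> cov (approx (Suc k) (p - Suc k)) (graft (snd a) (ms (fst a)) -` D (ms (fst a)) (snd a)) 1"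
    show "thin (approx (Suc k) (p - Suc k)) I X"
      unfolding thin_def
    proof (intro ballI impI allI)
      fix m n v assume mn: "m \<in> I" "n \<in> I" "m < n"
      then obtain j j' where j: "j < L" "m = ms j" "n = ms j'" by (auto simp: I_def)
      then have "j < j'" using mn(3) \<open>strict_mono ms\<close> by (simp add: strict_mono_less)
      then have "nx m \<le> n" unfolding j ms_Suc[symmetric]
        using \<open>strict_mono ms\<close> by (simp add: strict_mono_less_eq)
      obtain u where u: "u \<in> reps m" "agree m u v" using rep_exists by blast
      define a where "a = (j, u)"
      have a: "a \<in> J" "ms (fst a) = m" "snd a = u" using j u by (auto simp: a_def J_def)
      have "graft u m -` D m u \<subseteq> graft v m -` (- shadow n X)"
      proof
        fix z assume "z \<in> graft u m -` D m u"
        then have "graft v m z \<in> D m u"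
          using vimage_graft_cong[OF D(1)[OF u(1)] u(2)] by blast
        moreover have "agree m u (graft v m z)"
          using agree_graft agree_sym agree_trans u(2) by blast
        ultimately have "graft v m z \<in> H a" by (simp add: H_def a)
        moreover have "shadow n X \<subseteq> - H a"
          using cylinder_mono[OF Hcyl[OF a(1)]] a \<open>nx m \<le> n\<close>
          by (intro shadow_subset_cylinder cylinder_Compl) (auto simp: X_def)
        ultimately show "z \<in> graft v m -` (- shadow n X)" by blast
      qed
      moreover have "\<not> cov (approx (Suc k) (p - Suc k)) (graft u m -` D m u) 1"
        using p a by auto
      ultimately show "\<not> cov (approx (Suc k) (p - Suc k)) (graft v m -` (- shadow n X)) 1"
        using cov_mono[OF _ order_refl _ order_refl] by blast
    qed
  qed
  then have "(k, I, X) \<in> limit k"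
    using I by (intro limitI) (auto simp: L_def)
  moreover have "weight (k, I, X) < 2 powr (- real k) + \<epsilon> / 2"
    using I(3) \<open>0 < \<epsilon>\<close> by (simp add: weight_def L_def wt_N)
  ultimately have "cov (limit k) X (2 powr (- real k) + \<epsilon> / 2)"
    unfolding cov_def by (intro exI[of _ "{(k, I, X)}"]) auto
  moreover have "cov C (\<Union>a\<in>J. E i \<inter> H a) (\<epsilon> / 2)"
  proof (rule cov_UN[OF finJ])
    fix a assume a: "a \<in> J"
    then have "i0 (ms (fst a)) \<le> i"
      unfolding i_def J_def by (auto intro: member_le_sum)
    then show "cov C (E i \<inter> H a) (\<eta> (ms (fst a)))"
      using D(3)[of "snd a" "ms (fst a)" i] a by (auto simp: J_def H_def Int_assoc)
  next
    have "(\<Sum>a\<in>J. \<eta> (ms (fst a))) = (\<Sum>j<L. \<Sum>u\<in>reps (ms j). \<eta> (ms j))"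
      unfolding J_def using finite_reps by (subst sum.Sigma) (auto simp: split_beta)
    also have "\<dots> = (\<Sum>j<L. \<epsilon> / (4 * real L))"
      using reps by (intro sum.cong) (auto simp: \<eta>_def)
    also have "\<dots> = \<epsilon> / 4" using \<open>0 < L\<close> by simp
    finally show "(\<Sum>a\<in>J. \<eta> (ms (fst a))) < \<epsilon> / 2" using \<open>0 < \<epsilon>\<close> by simp
  qed
  then have "cov (limit k) (\<Union>a\<in>J. E i \<inter> H a) (\<epsilon> / 2)"
    using cov_mono[OF _ C(3)] by blast
  ultimately have "cov (limit k) (X \<union> (\<Union>a\<in>J. E i \<inter> H a)) (2 powr (- real k) + \<epsilon> / 2 + \<epsilon> / 2)"
    by (rule cov_Un)
  then have "cov (limit k) (E i) (2 powr (- real k) + \<epsilon>)"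
    by (rule cov_mono) (auto simp: X_def)
  then show ?thesis by blast
qed

section \<open>Pathology\<close>

text \<open>The cuts n and n+1 isolate coordinate n, and no index lies strictly between them, so
  every piece keeps half of its indices on one side. The pieces of each side weigh less than 2 after
  doubling and cannot cover that side; the middle interval gets no pieces and the value a.\<close>

lemma point_not_cov:
  assumes "a \<le> n"
  shows "\<not> cov (approx k j) {z. min (z n) n = a} 1"
proof
  let ?C = "approx k j"
  assume "cov ?C {z. min (z n) n = a} 1"
  then obtain F where F: "finite F" "F \<subseteq> ?C" "{z. min (z n) n = a} \<subseteq> \<Union>(st ` F)" "sum weight F < 1"
    unfolding cov_def by blast
  obtain M where M: "Suc n \<le> M" "\<forall>x\<in>F. ix x \<subseteq> {0..M}"
    using stable_bounded[OF stable_approx F(1,2)] by blast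
  define t where "t i = (if i = 0 then 0 else if i = 1 then n else if i = 2 then Suc n else M)" for i :: nat
  define Z where "Z i = (if i = 1 then {z. min (z n) n = a} else UNIV)" for i :: nat
  define P where "P i = (if i = 0 then {x\<in>F. half n x} else if i = 1 then {} else {x\<in>F. \<not> half n x})" for i :: nat
  have "mono t" using M(1) by (auto simp: mono_def t_def)
  have "\<exists>z. \<forall>i<3. z \<in> Z i \<and> (\<forall>x\<in>P i. z \<notin> st x)"
  proof (rule thread[OF \<open>mono t\<close>])
    fix i :: nat
    show "cylinder (t (Suc i)) (Z i)"
      by (auto simp: Z_def cylinder_UNIV t_def) (auto simp: cylinder_def agree_def)
  next
    fix i u assume i: "i < (3::nat)"
    have P: "finite (P i)" "P i \<subseteq> ?C" "P i \<subseteq> F" using F(1,2) by (auto simp: P_def)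
    have sum: "2 * sum weight (P i) < 16"
      using sum_weight_mono[OF F(1) P(3)] F(4) by linarith
    have mi: "t i \<le> t (Suc i)" using \<open>mono t\<close> by (simp add: mono_def)
    have not_cover: "\<not> graft u (t i) -` Z i \<subseteq> (\<Union>x\<in>P i. graft u (t i) -` shadow (t (Suc i)) (st x))"
      if "Z i = UNIV" and big: "\<And>x. x \<in> P i \<Longrightarrow> card (ix x) \<le> 2 ^ (lv x + 5) * card (ix x \<inter> {t i..t (Suc i)})"
    proof
      assume "graft u (t i) -` Z i \<subseteq> (\<Union>x\<in>P i. graft u (t i) -` shadow (t (Suc i)) (st x))"
      then have *: "UNIV \<subseteq> (\<Union>x\<in>P i. graft u (t i) -` shadow (t (Suc i)) (st x))"
        using \<open>Z i = UNIV\<close> by simp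
      have "cov ?C UNIV 16"
        by (rule cov_localize[OF stable_approx P(1,2) mi big scale_le_2 sum *])
      then show False using lower_bound_16 by blast
    qed
    consider "i = 1" | "i = 0" | "i = 2" using i by linarith
    then show "\<not> graft u (t i) -` Z i \<subseteq> (\<Union>x\<in>P i. graft u (t i) -` shadow (t (Suc i)) (st x))"
    proof cases
      case 1
      have "(\<lambda>_. a) \<in> graft u (t i) -` Z i" using assms 1 by (simp add: Z_def t_def graft_def)
      moreover have "P i = {}" using 1 by (simp add: P_def)
      ultimately show ?thesis by blast
    next
      case 2
      have "card (ix x) \<le> 2 ^ (lv x + 5) * card (ix x \<inter> {t i..t (Suc i)})" if "x \<in> P i" for x
        using that 2 half_scaled by (simp add: P_def t_def half_def)
      then show ?thesis
        using 2 by (intro not_cover) (simp_all add: Z_def)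
    next
      case 3
      have "card (ix x) \<le> 2 ^ (lv x + 5) * card (ix x \<inter> {t i..t (Suc i)})" if "x \<in> P i" for x
      proof (rule half_scaled)
        have x: "x \<in> F" "\<not> half n x" using that 3 by (auto simp: P_def)
        have "card (ix x) \<le> card (ix x \<inter> {0..n} \<union> ix x \<inter> {Suc n..M})"
          using M(2) x(1) by (intro card_mono) fastforce+
        also have "\<dots> \<le> card (ix x \<inter> {0..n}) + card (ix x \<inter> {Suc n..M})" by (rule card_Un_le)
        finally show "card (ix x) \<le> 2 * card (ix x \<inter> {t i..t (Suc i)})"
          using x(2) 3 by (simp add: half_def t_def)
      qed
      then show ?thesis
        using 3 by (intro not_cover) (simp_all add: Z_def)
    qed
  qed
  then obtain z where z: "\<And>i. i < 3 \<Longrightarrow> z \<in> Z i \<and> (\<forall>x\<in>P i. z \<notin> st x)" by blast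
  have "z \<in> Z 1" using z[of 1] by simp
  then obtain x where x: "x \<in> F" "z \<in> st x" using F(3) by (auto simp: Z_def)
  have "x \<in> P 0 \<or> x \<in> P 2" using x(1) by (simp add: P_def)
  then show False using z[of 0] z[of 2] x(2) by auto
qed

text \<open>The index n+1 is the cut just after coordinate n, so for m < n+1 that coordinate is
  still free in an atom of rank m. Giving it the forbidden value misses the set, and this is large
  by \<open>point_not_cov\<close>.\<close>

lemma avoiding_piece:
  assumes J: "finite J" "J \<noteq> {}" "card J \<le> N k" and \<tau>: "\<And>n. n \<in> J \<Longrightarrow> \<tau> n \<le> n"
  shows "(k, Suc ` J, {z. \<forall>n\<in>J. min (z n) n \<noteq> \<tau> n}) \<in> limit k"
proof (rule limitI)
  let ?X = "{z. \<forall>n\<in>J. min (z n) n \<noteq> \<tau> n}"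
  have "thin (approx k' j) (Suc ` J) ?X" for k' j
    unfolding thin_def
  proof (intro ballI impI allI)
    fix m n' u assume mn: "m \<in> Suc ` J" "n' \<in> Suc ` J" "m < n'"
    then obtain n where n: "n' = Suc n" "n \<in> J" by blast
    have "{z. min (z n) n = \<tau> n} \<subseteq> graft u m -` (- shadow n' ?X)"
    proof
      fix z assume z: "z \<in> {z. min (z n) n = \<tau> n}"
      have "\<not> agree n' x (graft u m z)" if "x \<in> ?X" for x
      proof
        assume "agree n' x (graft u m z)"
        then have "min (x n) n = min (graft u m z n) n" using n(1) by (simp add: agree_def)
        then show False using that z n mn(3) by (auto simp: graft_def)
      qed
      then show "z \<in> graft u m -` (- shadow n' ?X)" by (auto simp: shadow_def)
    qed
    then show "\<not> cov (approx k' j) (graft u m -` (- shadow n' ?X)) 1"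
      using point_not_cov[OF \<tau>[OF n(2)]] cov_mono[OF _ order_refl _ order_refl] by blast
  qed
  then show "eventually (\<lambda>p. thin (approx (Suc k) (p - Suc k)) (Suc ` J) ?X) ultra" by simp
qed (use J in \<open>auto simp: card_image\<close>)

section \<open>The submeasure\<close>

definition nu :: "(nat \<Rightarrow> nat) set \<Rightarrow> real" where
  "nu A = Inf {t. cov (limit 0) A t}"

definition clopen :: "(nat \<Rightarrow> nat) set \<Rightarrow> bool" where
  "clopen A \<longleftrightarrow> (\<exists>r. cylinder r A)"

lemma clopen_Compl: "clopen X \<Longrightarrow> clopen (- X)"
  unfolding clopen_def using cylinder_Compl by blast

lemma clopen_Un: "clopen X \<Longrightarrow> clopen Y \<Longrightarrow> clopen (X \<union> Y)"
  unfolding clopen_def using cylinder_Un cylinder_mono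
  by (metis max.cobounded1 max.cobounded2)

lemma clopen_empty: "clopen {}" and clopen_UNIV: "clopen UNIV"
  using cylinder_empty cylinder_UNIV by (auto simp: clopen_def)

lemma clopen_Diff: "clopen X \<Longrightarrow> clopen Y \<Longrightarrow> clopen (X - Y)"
  using clopen_Compl[of "- X \<union> Y"] clopen_Un[of "- X" Y] clopen_Compl[of X]
  by (simp add: Diff_eq)

lemma clopen_UN: "finite S \<Longrightarrow> (\<And>i. i \<in> S \<Longrightarrow> clopen (A i)) \<Longrightarrow> clopen (\<Union>i\<in>S. A i)"
  by (induction S rule: finite_induct) (auto simp: clopen_empty clopen_Un)

lemma clopen_coordinate: "clopen {z. P (min (z n) n)}"
  unfolding clopen_def cylinder_def by (rule exI[of _ "Suc n"]) (auto simp: agree_def)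

text \<open>With a single index there is no pair m < n to test, so even the whole space forms a
  piece. Hence the infimum in \<open>nu\<close> is over a nonempty set.\<close>

lemma cov_ex: "\<exists>t. cov (limit 0) A t"
proof -
  have "(0, {0}, UNIV) \<in> limit 0"
    by (rule limitI) (auto simp: thin_def N_def)
  then have "cov (limit 0) A (weight (0, {0}, UNIV) + 1)"
    unfolding cov_def by (intro exI[of _ "{(0, {0}, UNIV)}"]) auto
  then show ?thesis by blast
qed

lemma nu_less_iff: "nu A < t \<longleftrightarrow> cov (limit 0) A t"
proof
  assume "nu A < t"
  then obtain t' where "cov (limit 0) A t'" "t' < t"
    unfolding nu_def using cInf_lessD[of "{t. cov (limit 0) A t}" t] cov_ex[of A] by blast
  then show "cov (limit 0) A t" using cov_mono by (meson order_refl less_imp_le)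
next
  assume "cov (limit 0) A t"
  then obtain F where F: "finite F" "F \<subseteq> limit 0" "A \<subseteq> \<Union>(st ` F)" "sum weight F < t"
    unfolding cov_def by blast
  then obtain t' where t': "sum weight F < t'" "t' < t" using dense by blast
  then have "cov (limit 0) A t'" using F unfolding cov_def by blast
  moreover have "bdd_below {t. cov (limit 0) A t}"
    using cov_pos by (intro bdd_belowI[of _ 0]) (auto intro: less_imp_le)
  ultimately have "nu A \<le> t'" unfolding nu_def by (intro cInf_lower) auto
  then show "nu A < t" using t' by simp
qed

lemma nu_nonneg: "0 \<le> nu A"
  using nu_less_iff cov_pos by (metis less_irrefl not_le)

lemma nu_empty: "nu {} = 0"
  using nu_nonneg[of "{}"] nu_less_iff[of "{}"] cov_empty by (metis less_irrefl order_le_less)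

lemma nu_mono: "A \<subseteq> B \<Longrightarrow> nu A \<le> nu B"
  using nu_less_iff cov_mono by (metis dual_order.refl not_le)

lemma nu_Un: "nu (A \<union> B) \<le> nu A + nu B"
proof (rule field_le_epsilon)
  fix e :: real assume "0 < e"
  then have "cov (limit 0) A (nu A + e/2)" "cov (limit 0) B (nu B + e/2)"
    by (simp_all flip: nu_less_iff)
  then have "cov (limit 0) (A \<union> B) ((nu A + e/2) + (nu B + e/2))" by (rule cov_Un)
  then show "nu (A \<union> B) \<le> nu A + nu B + e" by (simp flip: nu_less_iff)
qed

lemma nu_UN: "finite S \<Longrightarrow> nu (\<Union>i\<in>S. A i) \<le> (\<Sum>i\<in>S. nu (A i))"
proof (induction S rule: finite_induct)
  case (insert i S)
  then show ?case using nu_Un[of "A i" "\<Union>i\<in>S. A i"] by simp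
qed (simp add: nu_empty)

lemma nu_UNIV: "16 \<le> nu UNIV"
  using lower_bound_limit nu_less_iff by (meson not_le)

lemma power_half_less:
  assumes "0 < (\<epsilon>::real)"
  shows "\<exists>k. 2 powr (- real k) < \<epsilon>"
  using real_arch_pow_inv[OF assms, of "1/2"] by (auto simp: powr_minus powr_realpow power_one_over inverse_eq_divide)

lemma nu_exhaustive:
  assumes "\<And>i. clopen (E i)" "\<And>i j :: nat. i < j \<Longrightarrow> E i \<inter> E j = {}" "0 < \<epsilon>"
  shows "\<exists>i. nu (E i) < \<epsilon>"
proof -
  obtain k where k: "2 powr (- real k) < \<epsilon> / 2" using power_half_less[of "\<epsilon>/2"] assms(3) by auto
  obtain i where "cov (limit k) (E i) (2 powr (- real k) + \<epsilon> / 2)"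
    using exhaustive_level[of "\<epsilon>/2" E k] assms unfolding clopen_def by auto
  then have "cov (limit 0) (E i) \<epsilon>"
    by (rule cov_mono) (use k limit_subset in auto)
  then show ?thesis using nu_less_iff by blast
qed

text \<open>Coordinate n splits the space into n+1 parts, one of which has at most the average mass.
  Forbidding this value in N k coordinates costs weight 2^-k in \<open>nu\<close> but loses little
  mass if the coordinates lie far out.\<close>

lemma nu_pathological:
  fixes m :: "(nat \<Rightarrow> nat) set \<Rightarrow> real"
  assumes m0: "\<And>X. clopen X \<Longrightarrow> 0 \<le> m X"
    and add: "\<And>X Y. clopen X \<Longrightarrow> clopen Y \<Longrightarrow> X \<inter> Y = {} \<Longrightarrow> m (X \<union> Y) = m X + m Y"
    and "0 < \<epsilon>" "0 < \<eta>"
  shows "\<exists>X. clopen X \<and> nu X < \<epsilon> \<and> m (- X) < \<eta>"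
proof -
  have m_empty: "m {} = 0" using add[of "{}" "{}"] clopen_empty by simp
  have m_UN: "m (\<Union>i\<in>S. A i) \<le> (\<Sum>i\<in>S. m (A i))"
    if "finite S" "\<And>i. i \<in> S \<Longrightarrow> clopen (A i)" for S and A :: "nat \<Rightarrow> (nat \<Rightarrow> nat) set"
    using that
  proof (induction S rule: finite_induct)
    case (insert i S)
    let ?U = "\<Union>i\<in>S. A i"
    have c: "clopen ?U" "clopen (A i)" using insert by (auto intro: clopen_UN)
    have "m (A i \<union> ?U) = m (A i) + m (?U - A i)"
      using add[OF c(2) clopen_Diff[OF c]] by (simp add: Un_Diff_cancel)
    moreover have "m ?U = m (?U \<inter> A i) + m (?U - A i)"
    proof -
      have "clopen (?U \<inter> A i)" using clopen_Diff[OF c(1) clopen_Compl[OF c(2)]] by (simp add: Diff_eq)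
      moreover have "?U = (?U \<inter> A i) \<union> (?U - A i)" by blast
      ultimately show ?thesis using add[of "?U \<inter> A i" "?U - A i"] clopen_Diff[OF c]
        by (metis Diff_disjoint Int_Diff Int_commute inf_bot_right)
    qed
    moreover have "0 \<le> m (?U \<inter> A i)"
      using m0 clopen_Diff[OF c(1) clopen_Compl[OF c(2)]] by (simp add: Diff_eq)
    ultimately show ?case using insert by simp
  qed (simp add: m_empty)
  obtain k where k: "2 powr (- real k) < \<epsilon>" using power_half_less[OF \<open>0 < \<epsilon>\<close>] by blast
  obtain n0 :: nat where n0: "real (N k) * m UNIV / \<eta> < real n0" using reals_Archimedean2 by blast
  have "\<exists>a\<le>n. m {z. min (z n) n = a} \<le> m UNIV / real (Suc n)" for n
  proof (rule ccontr)
    assume neg: "\<not> ?thesis"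
    have "(\<Sum>a\<le>l. m {z. min (z n) n = a}) = m {z. min (z n) n \<le> l}" for l
    proof (induction l)
      case (Suc l)
      have "{z. min (z n) n \<le> Suc l} = {z. min (z n) n \<le> l} \<union> {z. min (z n) n = Suc l}" by auto
      moreover have "m ({z. min (z n) n \<le> l} \<union> {z. min (z n) n = Suc l}) =
          m {z. min (z n) n \<le> l} + m {z. min (z n) n = Suc l}"
        by (rule add) (use clopen_coordinate[of "\<lambda>a. a \<le> l" n] clopen_coordinate[of "\<lambda>a. a = Suc l" n] in auto)
      ultimately show ?case using Suc by simp
    qed simp
    then have "m UNIV = (\<Sum>a\<le>n. m {z. min (z n) n = a})" by (simp add: min_le_iff_disj)
    also have "\<dots> > (\<Sum>a\<le>n. m UNIV / real (Suc n))"
    proof (rule sum_strict_mono)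
      fix a assume "a \<in> {..n}"
      then show "m UNIV / real (Suc n) < m {z. min (z n) n = a}" using neg by (meson atMost_iff not_le)
    qed auto
    also have "(\<Sum>a\<le>n. m UNIV / real (Suc n)) = m UNIV" by simp
    finally show False by simp
  qed
  then obtain \<tau> where \<tau>: "\<And>n. \<tau> n \<le> n" "\<And>n. m {z. min (z n) n = \<tau> n} \<le> m UNIV / real (Suc n)"
    by metis
  define J where "J = {n0..<n0 + N k}"
  have J: "finite J" "card J = N k" "J \<noteq> {}" by (auto simp: J_def N_def)
  define X where "X = {z. \<forall>n\<in>J. min (z n) n \<noteq> \<tau> n}"
  have co: "clopen {z. min (z n) n = \<tau> n}" for n
    using clopen_coordinate[of "\<lambda>a. a = \<tau> n"] .
  have X: "- X = (\<Union>n\<in>J. {z. min (z n) n = \<tau> n})" by (auto simp: X_def)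
  have "clopen (- X)" unfolding X by (rule clopen_UN[OF J(1) co])
  from clopen_Compl[OF this] have "clopen X" by (simp only: double_complement)
  moreover have "nu X < \<epsilon>"
  proof -
    have "(k, Suc ` J, X) \<in> limit k"
      unfolding X_def using J(2) \<tau>(1) by (intro avoiding_piece[OF J(1,3)]) auto
    then have "(k, Suc ` J, X) \<in> limit 0" using limit_subset by blast
    moreover have "weight (k, Suc ` J, X) = 2 powr (- real k)"
      using J by (simp add: weight_def card_image wt_N)
    ultimately have "cov (limit 0) X \<epsilon>"
      unfolding cov_def using k by (intro exI[of _ "{(k, Suc ` J, X)}"]) auto
    then show ?thesis by (simp add: nu_less_iff)
  qed
  moreover have "m (- X) < \<eta>"
  proof -
    have "m (- X) \<le> (\<Sum>n\<in>J. m {z. min (z n) n = \<tau> n})" unfolding X using co J(1) by (intro m_UN) auto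
    also have "\<dots> \<le> (\<Sum>n\<in>J. m UNIV / real (Suc n0))"
    proof (rule sum_mono)
      fix n assume "n \<in> J"
      then have "m UNIV / real (Suc n) \<le> m UNIV / real (Suc n0)"
        using m0[OF clopen_UNIV] by (intro divide_left_mono) (auto simp: J_def)
      then show "m {z. min (z n) n = \<tau> n} \<le> m UNIV / real (Suc n0)" using \<tau>(2)[of n] by linarith
    qed
    also have "\<dots> = real (N k) * m UNIV / real (Suc n0)" using J(2) by simp
    also have "\<dots> < \<eta>" using n0 \<open>0 < \<eta>\<close> by (simp add: field_simps)
    finally show ?thesis .
  qed
  ultimately show ?thesis by blast
qed

section \<open>Completion\<close>

text \<open>Koenig's lemma: an atom of rank r that is not finitely covered has such an atom of rank
  r+1 inside it, since only r+1 clipped values occur. The resulting branch is a point of X missed by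
  every A i.\<close>

lemma clopen_compact:
  assumes "clopen X" "\<And>i. clopen (A i)" "X \<subseteq> (\<Union>i. A i)"
  shows "\<exists>n::nat. X \<subseteq> (\<Union>i<n. A i)"
proof (rule ccontr)
  assume neg: "\<not> ?thesis"
  define P where "P r u \<longleftrightarrow> (\<forall>n. \<not> {z\<in>X. agree r u z} \<subseteq> (\<Union>i<n. A i))" for r u
  have "\<exists>f. \<forall>n. P n (f n) \<and> (\<exists>a. f (Suc n) = (f n)(n := a))"
  proof (rule dependent_nat_choice)
    show "\<exists>u. P 0 u" using neg by (auto simp: P_def agree_def)
  next
    fix u r assume Pu: "P r u"
    have "\<exists>a. P (Suc r) (u(r := a))"
    proof (rule ccontr)
      assume "\<not> ?thesis"
      then have "\<forall>a. \<exists>n. {z\<in>X. agree (Suc r) (u(r := a)) z} \<subseteq> (\<Union>i<n. A i)"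
        by (auto simp: P_def)
      then obtain n where n: "\<And>a. {z\<in>X. agree (Suc r) (u(r := a)) z} \<subseteq> (\<Union>i<n a. A i)" by metis
      have "{z\<in>X. agree r u z} \<subseteq> (\<Union>i<sum n {..r}. A i)"
      proof
        fix z assume z: "z \<in> {z\<in>X. agree r u z}"
        define a where "a = min (z r) r"
        have "agree (Suc r) (u(r := a)) z" using z by (auto simp: agree_def a_def less_Suc_eq)
        then have "z \<in> (\<Union>i<n a. A i)" using n[of a] z by blast
        moreover have "n a \<le> sum n {..r}" by (intro member_le_sum) (auto simp: a_def)
        ultimately show "z \<in> (\<Union>i<sum n {..r}. A i)" by fastforce
      qed
      then show False using Pu by (auto simp: P_def)
    qed
    then show "\<exists>v. P (Suc r) v \<and> (\<exists>a. v = u(r := a))" by blast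
  qed
  then obtain f where f: "\<And>n. P n (f n)" "\<And>n. \<exists>a. f (Suc n) = (f n)(n := a)" by blast
  define z where "z n = f (Suc n) n" for n
  have stab: "f m n = z n" if "n < m" for m n
    using that
  proof (induction m)
    case (Suc m)
    show ?case
    proof (cases "n = m")
      case False
      then show ?thesis using Suc f(2)[of m] by auto
    qed (simp add: z_def)
  qed simp
  have ag: "agree r (f r) z" for r unfolding agree_def using stab by simp
  obtain r where r: "cylinder r X" using assms(1) by (auto simp: clopen_def)
  obtain y where "y \<in> X" "agree r (f r) y" using f(1)[of r] by (auto simp: P_def)
  then have "z \<in> X" using cylinderD[OF r agree_trans[OF agree_sym[OF ag]]] by blast
  then obtain i where i: "z \<in> A i" using assms(3) by blast
  obtain r' where r': "cylinder r' (A i)" using assms(2)[of i] by (auto simp: clopen_def)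
  have "y \<in> A i" if "agree r' (f r') y" for y
    using i cylinderD[OF r' agree_trans[OF agree_sym[OF ag] that]] by blast
  then have "{y\<in>X. agree r' (f r') y} \<subseteq> (\<Union>i<Suc i. A i)" by blast
  then show False using f(1)[of r'] by (auto simp: P_def)
qed

section \<open>The outer submeasure from countable clopen covers\<close>

definition covers :: "(nat \<Rightarrow> nat) set \<Rightarrow> real \<Rightarrow> bool" where
  "covers E s \<longleftrightarrow> (\<exists>A :: nat \<Rightarrow> (nat \<Rightarrow> nat) set. (\<forall>i. clopen (A i)) \<and> E \<subseteq> (\<Union>i. A i) \<and>
     (\<forall>n. (\<Sum>i<n. nu (A i)) \<le> s))"

definition outer :: "(nat \<Rightarrow> nat) set \<Rightarrow> real" where
  "outer E = Inf {s. covers E s}"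

lemma covers_nonneg: "covers E s \<Longrightarrow> 0 \<le> s"
  unfolding covers_def by (metis lessThan_0 sum.empty)

lemma covers_clopen: "clopen A \<Longrightarrow> E \<subseteq> A \<Longrightarrow> covers E (nu A)"
  unfolding covers_def
proof (intro exI[of _ "\<lambda>i. if i = 0 then A else {}"] conjI allI)
  fix n :: nat
  have "(\<Sum>i<n. nu (if i = 0 then A else {})) = (\<Sum>i<n. if i = 0 then nu A else 0)"
    by (intro sum.cong) (auto simp: nu_empty)
  also have "\<dots> \<le> nu A" by (cases n) (simp_all add: nu_nonneg lessThan_Suc_eq_insert_0 sum.reindex)
  finally show "(\<Sum>i<n. nu (if i = 0 then A else {})) \<le> nu A" .
qed (auto simp: clopen_empty)

lemma covers_mono: "covers E s \<Longrightarrow> E' \<subseteq> E \<Longrightarrow> s \<le> s' \<Longrightarrow> covers E' s'"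
  unfolding covers_def by (meson order_trans)

lemma bdd_covers: "bdd_below {s. covers E s}"
  using covers_nonneg by (intro bdd_belowI[of _ 0]) auto

lemma outer_le: "covers E s \<Longrightarrow> outer E \<le> s"
  unfolding outer_def using bdd_covers by (intro cInf_lower) auto

lemma outer_less: "outer E < t \<Longrightarrow> covers E t"
  unfolding outer_def using cInf_lessD[of "{s. covers E s}" t] covers_clopen[OF clopen_UNIV, of E] covers_mono
  by (metis (no_types, lifting) empty_iff less_imp_le mem_Collect_eq order_refl subset_UNIV)

lemma outer_nonneg: "0 \<le> outer E"
  unfolding outer_def
  by (rule cInf_greatest) (use covers_clopen[OF clopen_UNIV, of E] covers_nonneg in auto)

lemma outer_mono: "E \<subseteq> F \<Longrightarrow> outer E \<le> outer F"
proof (rule field_le_epsilon)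
  fix e :: real assume "E \<subseteq> F" "0 < e"
  then show "outer E \<le> outer F + e"
    using outer_less[of F "outer F + e"] covers_mono outer_le by (metis less_add_same_cancel1 order_refl)
qed

lemma outer_clopen_le: "clopen A \<Longrightarrow> outer A \<le> nu A"
  by (intro outer_le covers_clopen) auto

lemma outer_empty: "outer {} = 0"
  using outer_clopen_le[OF clopen_empty] outer_nonneg[of "{}"] by (simp add: nu_empty)

text \<open>Compactness makes a countable clopen cover of the space finite, so admitting countable
  covers does not destroy the lower bound.\<close>

lemma outer_UNIV: "16 \<le> outer UNIV"
proof (rule ccontr)
  assume "\<not> ?thesis"
  then obtain s where s: "outer UNIV < s" "s < 16" using dense[of "outer UNIV" 16] by (auto simp: not_le)
  then obtain A where A: "\<And>i::nat. clopen (A i)" "UNIV \<subseteq> (\<Union>i. A i)" "\<And>n. (\<Sum>i<n. nu (A i)) \<le> s"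
    using outer_less[OF s(1)] unfolding covers_def by blast
  obtain n where "UNIV \<subseteq> (\<Union>i<n. A i)" using clopen_compact[OF clopen_UNIV A(1,2)] by blast
  then have "nu UNIV \<le> (\<Sum>i<n. nu (A i))"
    by (rule order_trans[OF nu_mono nu_UN]) simp
  then show False using A(3)[of n] s(2) nu_UNIV by linarith
qed

text \<open>The double sequence of clopen sets is enumerated by \<open>prod_decode\<close>. Each
  partial sum lies in a finite square, where the rows are bounded by \<open>s i\<close> and these in
  turn by S.\<close>

lemma outer_UN:
  assumes "\<And>i::nat. outer (E i) < s i" "\<And>n. (\<Sum>i<n. s i) \<le> S"
  shows "outer (\<Union>i. E i) \<le> S"
proof (rule outer_le)
  have "covers (E i) (s i)" for i using outer_less[OF assms(1)] .
  then obtain A where A: "\<And>i j::nat. clopen (A i j)" "\<And>i. E i \<subseteq> (\<Union>j. A i j)"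
      "\<And>i n. (\<Sum>j<n. nu (A i j)) \<le> s i"
    unfolding covers_def by metis
  define G where "G n = (case prod_decode n of (i, j) \<Rightarrow> A i j)" for n
  show "covers (\<Union>i. E i) S"
    unfolding covers_def
  proof (intro exI[of _ G] conjI allI)
    show "clopen (G n)" for n using A(1) by (simp add: G_def split_beta)
    show "(\<Union>i. E i) \<subseteq> (\<Union>n. G n)"
    proof
      fix z assume "z \<in> (\<Union>i. E i)"
      then obtain i j where "z \<in> A i j" using A(2) by blast
      then have "z \<in> G (prod_encode (i, j))" by (simp add: G_def)
      then show "z \<in> (\<Union>n. G n)" by blast
    qed
  next
    fix n
    define K where "K = Suc (Max (insert 0 (fst ` prod_decode ` {..<n} \<union> snd ` prod_decode ` {..<n})))"
    have sub: "prod_decode ` {..<n} \<subseteq> {..<K} \<times> {..<K}"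
    proof
      fix p assume "p \<in> prod_decode ` {..<n}"
      then have "fst p \<le> Max (insert 0 (fst ` prod_decode ` {..<n} \<union> snd ` prod_decode ` {..<n}))"
        "snd p \<le> Max (insert 0 (fst ` prod_decode ` {..<n} \<union> snd ` prod_decode ` {..<n}))"
        by (intro Max_ge; blast)+
      then show "p \<in> {..<K} \<times> {..<K}" unfolding K_def by (simp add: mem_Times_iff)
    qed
    have "(\<Sum>i<n. nu (G i)) = (\<Sum>(i,j)\<in>prod_decode ` {..<n}. nu (A i j))"
      by (subst sum.reindex) (auto simp: G_def split_beta inj_prod_decode)
    also have "\<dots> \<le> (\<Sum>(i,j)\<in>{..<K} \<times> {..<K}. nu (A i j))"
      using sub by (intro sum_mono2) (auto simp: nu_nonneg)
    also have "\<dots> = (\<Sum>i<K. \<Sum>j<K. nu (A i j))" by (simp add: sum.cartesian_product)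
    also have "\<dots> \<le> (\<Sum>i<K. s i)" using A(3) by (intro sum_mono)
    also have "\<dots> \<le> S" by (rule assms(2))
    finally show "(\<Sum>i<n. nu (G i)) \<le> S" .
  qed
qed

lemma sum_halves: "(\<Sum>k<n. e / 2 ^ Suc k) = e - e / 2 ^ n" for e :: real
  by (induction n) (auto simp: field_simps)

lemma sum_halves_le: "0 \<le> e \<Longrightarrow> (\<Sum>k<n. e / 2 ^ Suc k) \<le> e" for e :: real
  unfolding sum_halves by simp

lemma outer_Un: "outer (E \<union> F) \<le> outer E + outer F"
proof (rule field_le_epsilon)
  fix e :: real assume e: "0 < e"
  define G where "G i = (if i = 0 then E else if i = 1 then F else {})" for i :: nat
  define s where "s i = outer (G i) + e / 2 ^ Suc i" for i
  have "(\<Sum>i<n. outer (G i)) \<le> outer E + outer F" for n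
  proof -
    have "(\<Sum>i<n. outer (G i)) \<le> (\<Sum>i<n+2. outer (G i))"
      by (intro sum_mono2) (auto simp: outer_nonneg)
    also have "\<dots> = (\<Sum>i\<in>{0,1}. outer (G i))"
      by (rule sum.mono_neutral_right) (auto simp: G_def outer_empty)
    finally show ?thesis by (simp add: G_def)
  qed
  then have "(\<Sum>i<n. s i) \<le> outer E + outer F + e" for n
    unfolding s_def sum.distrib using sum_halves_le[of e n] e by (simp add: add_mono)
  then have "outer (\<Union>i. G i) \<le> outer E + outer F + e"
    using e by (intro outer_UN[of G s]) (simp_all add: s_def)
  moreover have "E \<union> F \<subseteq> (\<Union>i. G i)"
    unfolding G_def by (auto intro: exI[of _ 0] exI[of _ 1])
  ultimately show "outer (E \<union> F) \<le> outer E + outer F + e"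
    using outer_mono order_trans by blast
qed

lemma outer_UN_finite: "finite S \<Longrightarrow> outer (\<Union>i\<in>S. E i) \<le> (\<Sum>i\<in>S. outer (E i))"
proof (induction S rule: finite_induct)
  case (insert i S)
  then show ?case using outer_Un[of "E i" "\<Union>i\<in>S. E i"] by simp
qed (simp add: outer_empty)

lemma outer_le_Un: "E \<subseteq> F \<union> G \<Longrightarrow> outer E \<le> outer F + outer G"
  using outer_mono outer_Un order_trans by blast

text \<open>The closure of the clopen algebra in the pseudometric given by \<open>outer\<close> of
  symmetric differences. Caratheodory's splitting condition is tailored to additive set functions
  and is of no help here.\<close>

definition meas :: "(nat \<Rightarrow> nat) set \<Rightarrow> bool" where
  "meas E \<longleftrightarrow> (\<forall>\<epsilon>>0. \<exists>A. clopen A \<and> outer (sym_diff E A) < \<epsilon>)"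

lemma meas_clopen: "clopen A \<Longrightarrow> meas A"
  unfolding meas_def by (metis Diff_cancel Un_absorb outer_empty)

lemma meas_Compl: "meas E \<Longrightarrow> meas (- E)"
  unfolding meas_def
proof (intro allI impI)
  fix \<epsilon> :: real assume *: "\<forall>\<epsilon>>0. \<exists>A. clopen A \<and> outer (sym_diff E A) < \<epsilon>" "0 < \<epsilon>"
  then obtain A where A: "clopen A" "outer (sym_diff E A) < \<epsilon>" by blast
  have "sym_diff (- E) (- A) = sym_diff E A" by blast
  then show "\<exists>A. clopen A \<and> outer (sym_diff (- E) A) < \<epsilon>" using A clopen_Compl by metis
qed

lemma meas_Un:
  assumes "meas E" "meas F"
  shows "meas (E \<union> F)"
  unfolding meas_def
proof (intro allI impI)
  fix \<epsilon> :: real assume "0 < \<epsilon>"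
  then have "0 < \<epsilon> / 2" by simp
  then obtain A B where AB: "clopen A" "outer (sym_diff E A) < \<epsilon> / 2" "clopen B" "outer (sym_diff F B) < \<epsilon> / 2"
    using assms unfolding meas_def by meson
  have "sym_diff (E \<union> F) (A \<union> B) \<subseteq> sym_diff E A \<union> sym_diff F B" by blast
  from outer_le_Un[OF this] show "\<exists>C. clopen C \<and> outer (sym_diff (E \<union> F) C) < \<epsilon>"
    using AB clopen_Un by (intro exI[of _ "A \<union> B"]) auto
qed

lemma meas_Int: "meas E \<Longrightarrow> meas F \<Longrightarrow> meas (E \<inter> F)"
  using meas_Compl[of "- E \<union> - F"] meas_Un[of "- E" "- F"] meas_Compl by (simp add: Compl_Un)

lemma meas_Diff: "meas E \<Longrightarrow> meas F \<Longrightarrow> meas (E - F)"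
  using meas_Int[of E "- F"] meas_Compl by (simp add: Diff_eq)

lemma meas_UN_finite: "finite S \<Longrightarrow> (\<And>i. i \<in> S \<Longrightarrow> meas (E i)) \<Longrightarrow> meas (\<Union>i\<in>S. E i)"
  by (induction S rule: finite_induct) (auto simp: meas_clopen clopen_empty meas_Un)

text \<open>Clopen approximations with summable errors are made disjoint. A point of
  \<open>E i\<close> lost on the way is either outside \<open>A i\<close> or in some
  \<open>A j\<close> with j < i, hence outside \<open>E j\<close>; both times it lies in one of the
  symmetric differences.\<close>

lemma outer_exhaustive:
  assumes "\<And>i. meas (E i)" "\<And>i j :: nat. i < j \<Longrightarrow> E i \<inter> E j = {}" "0 < \<epsilon>"
  shows "\<exists>i. outer (E i) < \<epsilon>"
proof -
  define \<delta> where "\<delta> = \<epsilon> / 2"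
  have "\<delta> > 0" using assms(3) by (simp add: \<delta>_def)
  have "\<forall>i. \<exists>A. clopen A \<and> outer (sym_diff (E i) A) < \<delta> / 2 ^ Suc i"
    using assms(1) \<open>\<delta> > 0\<close> unfolding meas_def by simp
  then obtain A where A: "\<And>i. clopen (A i)" "\<And>i. outer (sym_diff (E i) (A i)) < \<delta> / 2 ^ Suc i"
    by metis
  define A' where "A' i = A i - (\<Union>j<i. A j)" for i
  have "clopen (A' i)" for i unfolding A'_def using A(1) by (intro clopen_Diff clopen_UN) auto
  moreover have "A' i \<inter> A' j = {}" if "i < j" for i j using that by (auto simp: A'_def)
  ultimately obtain i where i: "nu (A' i) < \<delta>" using nu_exhaustive \<open>\<delta> > 0\<close> by blast
  have "E i \<subseteq> A' i \<union> (\<Union>j<Suc i. sym_diff (E j) (A j))"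
  proof
    fix z assume z: "z \<in> E i"
    show "z \<in> A' i \<union> (\<Union>j<Suc i. sym_diff (E j) (A j))"
    proof (cases "\<exists>j<i. z \<in> A j")
      case True
      then obtain j where j: "j < i" "z \<in> A j" by blast
      then have "z \<notin> E j" using assms(2)[of j i] z by blast
      then show ?thesis using j by auto
    qed (use z in \<open>auto simp: A'_def\<close>)
  qed
  then have "outer (E i) \<le> outer (A' i) + outer (\<Union>j<Suc i. sym_diff (E j) (A j))"
    by (rule outer_le_Un)
  also have "outer (\<Union>j<Suc i. sym_diff (E j) (A j)) \<le> (\<Sum>j<Suc i. outer (sym_diff (E j) (A j)))"
    by (rule outer_UN_finite) simp
  also have "\<dots> \<le> (\<Sum>j<Suc i. \<delta> / 2 ^ Suc j)"
    using A(2) by (intro sum_mono less_imp_le)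
  also have "\<dots> \<le> \<delta>" using \<open>\<delta> > 0\<close> by (intro sum_halves_le) simp
  also have "outer (A' i) < \<delta>" using outer_clopen_le[OF \<open>clopen (A' i)\<close>] i by simp
  finally show ?thesis by (auto simp: \<delta>_def)
qed

text \<open>If finite blocks did not become small, infinitely many disjoint ones would contradict
  exhaustivity. A tail is then cut into finite blocks with geometrically decreasing bounds. Only
  finite unions enter the first step because countable ones are not yet known to be
  measurable.\<close>

lemma outer_tail:
  assumes E: "\<And>i. meas (E i)" "\<And>i j :: nat. i < j \<Longrightarrow> E i \<inter> E j = {}" and "0 < \<epsilon>"
  shows "\<exists>n. outer (\<Union>i\<in>{n..}. E i) < \<epsilon>"
proof -
  have block: "\<exists>n. \<forall>m. outer (\<Union>i\<in>{n..<m}. E i) < \<delta>" if "0 < \<delta>" for \<delta>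
  proof (rule ccontr)
    assume "\<not> ?thesis"
    then obtain m where m: "\<And>n. \<delta> \<le> outer (\<Union>i\<in>{n..<m n}. E i)" by (metis not_le)
    have lt: "n < m n" for n
    proof (rule ccontr)
      assume "\<not> n < m n"
      then show False using m[of n] \<open>0 < \<delta>\<close> by (simp add: outer_empty)
    qed
    define ns where "ns k = (m ^^ k) 0" for k
    have ns: "ns (Suc k) = m (ns k)" for k by (simp add: ns_def)
    have "strict_mono ns" unfolding strict_mono_Suc_iff ns using lt by simp
    define G where "G k = (\<Union>i\<in>{ns k..<ns (Suc k)}. E i)" for k
    have "meas (G k)" for k unfolding G_def using E(1) by (intro meas_UN_finite) auto
    moreover have "G j \<inter> G k = {}" if "j < k" for j k
    proof -
      have "ns (Suc j) \<le> ns k" using that \<open>strict_mono ns\<close> by (simp add: strict_mono_less_eq)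
      then have "E a \<inter> E b = {}" if "a < ns (Suc j)" "ns k \<le> b" for a b
        using that by (intro E(2)) linarith
      then show ?thesis unfolding G_def by fastforce
    qed
    ultimately obtain k where "outer (G k) < \<delta>" using outer_exhaustive \<open>0 < \<delta>\<close> by blast
    then show False using m[of "ns k"] by (simp add: G_def ns)
  qed
  define \<delta> where "\<delta> = \<epsilon> / 2"
  have "\<delta> > 0" using \<open>0 < \<epsilon>\<close> by (simp add: \<delta>_def)
  have "\<forall>k. \<exists>n. \<forall>m. outer (\<Union>i\<in>{n..<m}. E i) < \<delta> / 2 ^ Suc k"
    using block \<open>\<delta> > 0\<close> by simp
  then obtain nn where nn: "\<And>k m. outer (\<Union>i\<in>{nn k..<m}. E i) < \<delta> / 2 ^ Suc k" by metis
  define ns where "ns k = sum nn {..k} + k" for k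
  have "strict_mono ns" unfolding strict_mono_Suc_iff by (simp add: ns_def)
  have small: "outer (\<Union>i\<in>{ns k..<ns (Suc k)}. E i) < \<delta> / 2 ^ Suc k" for k
  proof -
    have "nn k \<le> ns k" unfolding ns_def by (simp add: sum.atMost_Suc_shift trans_le_add1 member_le_sum)
    then have "(\<Union>i\<in>{ns k..<ns (Suc k)}. E i) \<subseteq> (\<Union>i\<in>{nn k..<ns (Suc k)}. E i)" by fastforce
    then show ?thesis using nn[of k "ns (Suc k)"] outer_mono by (meson order_le_less_trans)
  qed
  have "outer (\<Union>k. \<Union>i\<in>{ns k..<ns (Suc k)}. E i) \<le> \<delta>"
    using small sum_halves_le \<open>\<delta> > 0\<close> by (intro outer_UN) (auto simp: less_imp_le)
  moreover have "(\<Union>i\<in>{ns 0..}. E i) \<subseteq> (\<Union>k. \<Union>i\<in>{ns k..<ns (Suc k)}. E i)"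
  proof
    fix z assume "z \<in> (\<Union>i\<in>{ns 0..}. E i)"
    then obtain i where i: "ns 0 \<le> i" "z \<in> E i" by auto
    have "i < ns (Suc i)" by (simp add: ns_def)
    define k where "k = (LEAST k. i < ns (Suc k))"
    have k: "i < ns (Suc k)" unfolding k_def using \<open>i < ns (Suc i)\<close> by (rule LeastI)
    have "ns k \<le> i"
    proof (cases k)
      case (Suc k')
      then have "\<not> i < ns (Suc k')" unfolding k_def using not_less_Least[of k' "\<lambda>k. i < ns (Suc k)"] by simp
      then show ?thesis using Suc by simp
    qed (use i in simp)
    then show "z \<in> (\<Union>k. \<Union>i\<in>{ns k..<ns (Suc k)}. E i)" using i(2) k by fastforce
  qed
  ultimately have "outer (\<Union>i\<in>{ns 0..}. E i) \<le> \<delta>" using outer_mono order_trans by blast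
  then show ?thesis using \<open>0 < \<epsilon>\<close> by (intro exI[of _ "ns 0"]) (simp add: \<delta>_def)
qed

text \<open>After making the sets disjoint, \<open>outer_tail\<close> renders all but finitely many
  of them jointly negligible.\<close>

lemma meas_UN:
  assumes "\<And>i::nat. meas (E i)"
  shows "meas (\<Union>i. E i)"
  unfolding meas_def
proof (intro allI impI)
  fix \<epsilon> :: real assume "0 < \<epsilon>"
  define G where "G i = E i - (\<Union>j<i. E j)" for i
  have G: "meas (G i)" for i unfolding G_def using assms by (intro meas_Diff meas_UN_finite) auto
  have GE: "(\<Union>i. G i) = (\<Union>i. E i)"
  proof (intro equalityI subsetI)
    fix z assume "z \<in> (\<Union>i. E i)"
    then have ex: "\<exists>i. z \<in> E i" by blast
    have "z \<in> E (LEAST i. z \<in> E i)" "\<And>j. j < (LEAST i. z \<in> E i) \<Longrightarrow> z \<notin> E j"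
      using LeastI_ex[OF ex] not_less_Least by blast+
    then show "z \<in> (\<Union>i. G i)" unfolding G_def by blast
  qed (auto simp: G_def)
  have "G i \<inter> G j = {}" if "i < j" for i j using that by (auto simp: G_def)
  then have "\<exists>n. outer (\<Union>i\<in>{n..}. G i) < \<epsilon> / 2"
    using \<open>0 < \<epsilon>\<close> by (intro outer_tail G) auto
  then obtain n where n: "outer (\<Union>i\<in>{n..}. G i) < \<epsilon> / 2" by blast
  have "meas (\<Union>i<n. G i)" using G by (intro meas_UN_finite) auto
  then obtain A where A: "clopen A" "outer (sym_diff (\<Union>i<n. G i) A) < \<epsilon> / 2"
    unfolding meas_def using \<open>0 < \<epsilon>\<close> by (meson half_gt_zero)
  have "(\<Union>i. E i) = (\<Union>i<n. G i) \<union> (\<Union>i\<in>{n..}. G i)"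
  proof -
    have "UNIV = {..<n} \<union> {n..}" by auto
    then show ?thesis unfolding GE[symmetric] by (metis UN_Un)
  qed
  then have "sym_diff (\<Union>i. E i) A \<subseteq> sym_diff (\<Union>i<n. G i) A \<union> (\<Union>i\<in>{n..}. G i)"
    by blast
  from outer_le_Un[OF this] show "\<exists>A. clopen A \<and> outer (sym_diff (\<Union>i. E i) A) < \<epsilon>"
    using A n by (intro exI[of _ A]) auto
qed

text \<open>Up to the null intersection, \<open>D n\<close> is the union of the later differences,
  which form a tail of a disjoint sequence.\<close>

lemma outer_continuous:
  assumes D: "\<And>n. meas (D n)" "decseq D" and null: "outer (\<Inter>n. D n) = 0"
  shows "(\<lambda>n. outer (D n)) \<longlonglongrightarrow> 0"
proof (rule LIMSEQ_I)
  fix \<epsilon> :: real assume "0 < \<epsilon>"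
  define G where "G i = D i - D (Suc i)" for i
  have "meas (G i)" for i unfolding G_def using D(1) by (intro meas_Diff)
  moreover have "G i \<inter> G j = {}" if "i < j" for i j
    using decseqD[OF D(2), of "Suc i" j] that by (auto simp: G_def)
  ultimately obtain n where n: "outer (\<Union>i\<in>{n..}. G i) < \<epsilon>"
    using outer_tail[of G] \<open>0 < \<epsilon>\<close> by blast
  have "D n \<subseteq> (\<Inter>n. D n) \<union> (\<Union>i\<in>{n..}. G i)"
  proof
    fix z assume z: "z \<in> D n"
    show "z \<in> (\<Inter>n. D n) \<union> (\<Union>i\<in>{n..}. G i)"
    proof (cases "\<exists>i\<ge>n. z \<in> G i")
      case False
      then have "z \<in> D (n + j)" for j
        by (induction j) (use z in \<open>auto simp: G_def\<close>)
      then have "z \<in> D j" for j using decseqD[OF D(2), of j "n + j"] by auto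
      then show ?thesis by blast
    qed auto
  qed
  from outer_le_Un[OF this] have "outer (D n) < \<epsilon>" using n null by simp
  then have "outer (D j) < \<epsilon>" if "n \<le> j" for j
    using outer_mono[OF decseqD[OF D(2) that]] by simp
  then show "\<exists>n0. \<forall>n\<ge>n0. norm (outer (D n) - 0) < \<epsilon>"
    using outer_nonneg by (intro exI[of _ n]) simp
qed

lemma meas_INT:
  assumes "\<And>i::nat. meas (E i)"
  shows "meas (\<Inter>i. E i)"
  using meas_Compl[OF meas_UN[of "\<lambda>i. - E i"]] meas_Compl[OF assms] by simp

section \<open>The quotient algebra\<close>

definition cls :: "(nat \<Rightarrow> nat) set \<Rightarrow> (nat \<Rightarrow> nat) set set" where
  "cls E = {F. meas F \<and> outer (sym_diff E F) = 0}"

definition quot :: "(nat \<Rightarrow> nat) set set gorder" where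
  "quot = \<lparr>carrier = cls ` Collect meas, eq = (=), le = \<lambda>X Y. \<exists>E\<in>X. \<exists>F\<in>Y. outer (E - F) = 0\<rparr>"

lemma outer_zeroI: "E \<subseteq> F \<union> G \<Longrightarrow> outer F = 0 \<Longrightarrow> outer G = 0 \<Longrightarrow> outer E = 0"
  using outer_le_Un[of E F G] outer_nonneg[of E] by simp

lemma outer_zero_mono: "outer F = 0 \<Longrightarrow> E \<subseteq> F \<Longrightarrow> outer E = 0"
  using outer_mono[of E F] outer_nonneg[of E] by simp

lemma outer_zero_UN:
  assumes "\<And>i::nat. outer (E i) = 0"
  shows "outer (\<Union>i. E i) = 0"
proof (rule antisym)
  show "outer (\<Union>i. E i) \<le> 0"
  proof (rule field_le_epsilon)
    fix e :: real assume "0 < e"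
    then show "outer (\<Union>i. E i) \<le> 0 + e"
      using assms sum_halves_le[of e] by (intro outer_UN[of E "\<lambda>k. e / 2 ^ Suc k"]) auto
  qed
qed (rule outer_nonneg)

lemma cls_self: "meas E \<Longrightarrow> E \<in> cls E"
  by (simp add: cls_def outer_empty)

lemma cls_eq_iff:
  assumes "meas E" "meas F"
  shows "cls E = cls F \<longleftrightarrow> outer (E - F) = 0 \<and> outer (F - E) = 0"
proof
  assume "cls E = cls F"
  then have "outer (sym_diff E F) = 0" using cls_self[OF assms(2)] unfolding cls_def by blast
  then show "outer (E - F) = 0 \<and> outer (F - E) = 0" using outer_zero_mono by blast
next
  assume *: "outer (E - F) = 0 \<and> outer (F - E) = 0"
  have "outer (sym_diff E G) = 0 \<longleftrightarrow> outer (sym_diff F G) = 0" for G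
  proof -
    have "outer (sym_diff E F) = 0" using * outer_zeroI[of "sym_diff E F"] by blast
    moreover have "sym_diff E G \<subseteq> sym_diff E F \<union> sym_diff F G" "sym_diff F G \<subseteq> sym_diff E F \<union> sym_diff E G"
      by blast+
    ultimately show ?thesis using outer_zeroI by metis
  qed
  then show "cls E = cls F" by (simp add: cls_def)
qed

lemma le_cls:
  assumes "meas E" "meas F"
  shows "cls E \<sqsubseteq>\<^bsub>quot\<^esub> cls F \<longleftrightarrow> outer (E - F) = 0"
proof
  assume "cls E \<sqsubseteq>\<^bsub>quot\<^esub> cls F"
  then obtain E' F' where "outer (sym_diff E E') = 0" "outer (sym_diff F F') = 0" "outer (E' - F') = 0"
    unfolding quot_def cls_def by auto
  moreover have "E - F \<subseteq> sym_diff E E' \<union> (sym_diff F F' \<union> (E' - F'))" by blast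
  ultimately show "outer (E - F) = 0" using outer_zeroI by (metis order_refl)
next
  assume "outer (E - F) = 0"
  then show "cls E \<sqsubseteq>\<^bsub>quot\<^esub> cls F" using cls_self assms by (auto simp: quot_def)
qed

lemma cls_mono: "meas E \<Longrightarrow> meas F \<Longrightarrow> E \<subseteq> F \<Longrightarrow> cls E \<sqsubseteq>\<^bsub>quot\<^esub> cls F"
  using le_cls[of E F] outer_empty by (metis Diff_eq_empty_iff)

lemma carrier_quot: "X \<in> carrier quot \<longleftrightarrow> (\<exists>E. meas E \<and> X = cls E)"
  by (auto simp: quot_def)

lemma cls_carrier: "meas E \<Longrightarrow> cls E \<in> carrier quot"
  by (auto simp: carrier_quot)

lemma eq_quot [simp]: "(.=\<^bsub>quot\<^esub>) = (=)"
  by (simp add: quot_def)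

interpretation quot: partial_order quot
proof
  fix X Y assume "X \<in> carrier quot" "Y \<in> carrier quot" "X \<sqsubseteq>\<^bsub>quot\<^esub> Y" "Y \<sqsubseteq>\<^bsub>quot\<^esub> X"
  then show "X .=\<^bsub>quot\<^esub> Y"
    unfolding eq_quot carrier_quot by (metis le_cls cls_eq_iff)
next
  fix X Y Z assume *: "X \<in> carrier quot" "Y \<in> carrier quot" "Z \<in> carrier quot"
    "X \<sqsubseteq>\<^bsub>quot\<^esub> Y" "Y \<sqsubseteq>\<^bsub>quot\<^esub> Z"
  then obtain E F G where "meas E" "meas F" "meas G" "X = cls E" "Y = cls F" "Z = cls G"
    by (auto simp: carrier_quot)
  moreover have "E - G \<subseteq> (E - F) \<union> (F - G)" by blast
  ultimately show "X \<sqsubseteq>\<^bsub>quot\<^esub> Z" using * outer_zeroI[of "E - G" "E - F" "F - G"] by (simp add: le_cls)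
qed (auto simp: carrier_quot le_cls outer_empty)

lemma lub_UN:
  assumes "\<And>i::nat. meas (E i)"
  shows "is_lub quot (cls (\<Union>i. E i)) (range (\<lambda>i. cls (E i)))"
proof (rule least_UpperI)
  fix X assume "X \<in> range (\<lambda>i. cls (E i))"
  then obtain i where "X = cls (E i)" by blast
  then show "X \<sqsubseteq>\<^bsub>quot\<^esub> cls (\<Union>i. E i)"
    using cls_mono[of "E i" "\<Union>i. E i"] assms meas_UN by blast
next
  fix Y assume "Y \<in> Upper quot (range (\<lambda>i. cls (E i)))"
  then obtain F where F: "meas F" "Y = cls F" "\<And>i. cls (E i) \<sqsubseteq>\<^bsub>quot\<^esub> Y"
    using cls_carrier[OF assms] by (auto simp: Upper_def carrier_quot)
  then have "outer (\<Union>i. E i - F) = 0" using assms by (intro outer_zero_UN) (simp add: le_cls)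
  then show "cls (\<Union>i. E i) \<sqsubseteq>\<^bsub>quot\<^esub> Y"
    using F(1,2) assms by (simp add: le_cls meas_UN)
qed (use assms meas_UN cls_carrier in auto)

lemma lub_Un:
  assumes "meas E" "meas F"
  shows "is_lub quot (cls (E \<union> F)) {cls E, cls F}"
proof -
  define G where "G i = (if i = 0 then E else F)" for i :: nat
  have "(\<Union>i. G i) = E \<union> F" "range (\<lambda>i. cls (G i)) = {cls E, cls F}"
    by (auto simp: G_def split: if_splits intro: exI[of _ 0] exI[of _ 1])
  moreover have "meas (G i)" for i using assms by (simp add: G_def)
  ultimately show ?thesis using lub_UN[of G] by simp
qed

lemma glb_Int:
  assumes "meas E" "meas F"
  shows "is_glb quot (cls (E \<inter> F)) {cls E, cls F}"
proof (rule greatest_LowerI)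
  show "cls (E \<inter> F) \<sqsubseteq>\<^bsub>quot\<^esub> X" if "X \<in> {cls E, cls F}" for X
    using that assms meas_Int cls_mono[of "E \<inter> F" E] cls_mono[of "E \<inter> F" F] by blast
next
  fix Y assume "Y \<in> Lower quot {cls E, cls F}"
  then obtain G where G: "meas G" "Y = cls G" "Y \<sqsubseteq>\<^bsub>quot\<^esub> cls E" "Y \<sqsubseteq>\<^bsub>quot\<^esub> cls F"
    using cls_carrier assms by (auto simp: Lower_def carrier_quot)
  moreover have "G - E \<inter> F \<subseteq> (G - E) \<union> (G - F)" by blast
  ultimately show "Y \<sqsubseteq>\<^bsub>quot\<^esub> cls (E \<inter> F)"
    using assms outer_zeroI[of "G - E \<inter> F" "G - E" "G - F"] by (simp add: le_cls meas_Int)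
qed (use assms meas_Int cls_carrier in auto)

lemma join_cls: "meas E \<Longrightarrow> meas F \<Longrightarrow> cls E \<squnion>\<^bsub>quot\<^esub> cls F = cls (E \<union> F)"
  unfolding join_def sup_def using lub_Un quot.least_unique by (intro some_equality) auto

lemma meet_cls: "meas E \<Longrightarrow> meas F \<Longrightarrow> cls E \<sqinter>\<^bsub>quot\<^esub> cls F = cls (E \<inter> F)"
  unfolding meet_def inf_def using glb_Int quot.greatest_unique by (intro some_equality) auto

lemmas meas_empty = meas_clopen[OF clopen_empty] and meas_UNIV = meas_clopen[OF clopen_UNIV]

lemma least_quot: "least quot (cls {}) (carrier quot)"
  using meas_empty by (auto simp: least_def carrier_quot le_cls outer_empty)

lemma greatest_quot: "greatest quot (cls UNIV) (carrier quot)"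
  using meas_UNIV by (auto simp: greatest_def carrier_quot le_cls outer_empty)

lemma bottom_quot: "\<bottom>\<^bsub>quot\<^esub> = cls {}"
  unfolding bottom_def using least_quot quot.least_unique by (intro some_equality) auto

lemma top_quot: "\<top>\<^bsub>quot\<^esub> = cls UNIV"
  unfolding top_def using greatest_quot quot.greatest_unique by (intro some_equality) auto

lemma cls_bottom_iff: "meas E \<Longrightarrow> cls E = \<bottom>\<^bsub>quot\<^esub> \<longleftrightarrow> outer E = 0"
  using meas_empty by (simp add: bottom_quot cls_eq_iff outer_empty)

lemma sigma_complete_quot: "sigma_complete_boolean_lattice quot"
proof
  fix X Y assume "X \<in> carrier quot" "Y \<in> carrier quot"
  then obtain E F where "meas E" "meas F" "X = cls E" "Y = cls F" by (auto simp: carrier_quot)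
  then show "\<exists>s. is_lub quot s {X, Y}" "\<exists>s. is_glb quot s {X, Y}" using lub_Un glb_Int by blast+
next
  show "\<exists>x. least quot x (carrier quot)" "\<exists>x. greatest quot x (carrier quot)"
    using least_quot greatest_quot by blast+
next
  fix X Y Z assume "X \<in> carrier quot" "Y \<in> carrier quot" "Z \<in> carrier quot"
  then obtain E F G where "meas E" "meas F" "meas G" "X = cls E" "Y = cls F" "Z = cls G"
    by (auto simp: carrier_quot)
  then show "X \<sqinter>\<^bsub>quot\<^esub> (Y \<squnion>\<^bsub>quot\<^esub> Z) = X \<sqinter>\<^bsub>quot\<^esub> Y \<squnion>\<^bsub>quot\<^esub> (X \<sqinter>\<^bsub>quot\<^esub> Z)"
    by (simp add: join_cls meet_cls meas_Un meas_Int Int_Un_distrib)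
next
  fix X assume "X \<in> carrier quot"
  then obtain E where E: "meas E" "X = cls E" by (auto simp: carrier_quot)
  then show "\<exists>Y\<in>carrier quot. X \<sqinter>\<^bsub>quot\<^esub> Y = \<bottom>\<^bsub>quot\<^esub> \<and> X \<squnion>\<^bsub>quot\<^esub> Y = \<top>\<^bsub>quot\<^esub>"
    using meas_Compl[OF E(1)] cls_carrier
    by (intro bexI[of _ "cls (- E)"]) (auto simp: join_cls meet_cls bottom_quot top_quot)
next
  fix A assume A: "A \<subseteq> carrier quot" "countable A"
  show "\<exists>s. is_lub quot s A"
  proof (cases "A = {}")
    case True
    then show ?thesis using least_quot by (auto simp: Upper_def)
  next
    case False
    then obtain f :: "nat \<Rightarrow> (nat \<Rightarrow> nat) set set" where f: "A = range f"
      using A(2) range_from_nat_into by metis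
    then have "\<forall>i. \<exists>E. meas E \<and> f i = cls E" using A(1) carrier_quot by blast
    then obtain E where E: "\<And>i. meas (E i)" "\<And>i. f i = cls (E i)" by metis
    show ?thesis unfolding f E(2) using lub_UN[of E, OF E(1)] by (rule exI)
  qed
qed

section \<open>The induced submeasure and its continuity\<close>

definition quot_sub :: "(nat \<Rightarrow> nat) set set \<Rightarrow> real" where
  "quot_sub X = outer (SOME E. E \<in> X)"

lemma quot_sub_cls:
  assumes "meas E"
  shows "quot_sub (cls E) = outer E"
proof -
  define F where "F = (SOME F. F \<in> cls E)"
  have "F \<in> cls E" unfolding F_def using cls_self[OF assms] by (rule someI)
  then have "outer (sym_diff E F) = 0" by (simp add: cls_def)
  moreover have "E \<subseteq> F \<union> sym_diff E F" "F \<subseteq> E \<union> sym_diff E F" by blast+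
  ultimately have "outer E = outer F"
    using outer_le_Un[of E F "sym_diff E F"] outer_le_Un[of F E "sym_diff E F"] by linarith
  then show ?thesis by (simp add: quot_sub_def F_def)
qed

lemma submeasure_quot: "submeasure quot quot_sub"
  unfolding submeasure_def
proof (intro conjI ballI impI)
  show "quot_sub \<bottom>\<^bsub>quot\<^esub> = 0" by (simp add: bottom_quot quot_sub_cls meas_empty outer_empty)
next
  fix X assume "X \<in> carrier quot"
  then show "0 \<le> quot_sub X" by (auto simp: carrier_quot quot_sub_cls outer_nonneg)
next
  fix X Y assume "X \<in> carrier quot" "Y \<in> carrier quot"
  then obtain E F where EF: "meas E" "meas F" "X = cls E" "Y = cls F" by (auto simp: carrier_quot)
  then show "quot_sub (X \<squnion>\<^bsub>quot\<^esub> Y) \<le> quot_sub X + quot_sub Y"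
    by (simp add: join_cls quot_sub_cls meas_Un outer_Un)
  assume "X \<sqsubseteq>\<^bsub>quot\<^esub> Y"
  then have "outer (E - F) = 0" using EF by (simp add: le_cls)
  then show "quot_sub X \<le> quot_sub Y"
    using EF outer_le_Un[of E "E - F" F] by (auto simp: quot_sub_cls)
qed

text \<open>Lets abstract continuity be applied to a concrete sequence of sets with null
  intersection; a lower bound lies in every \<open>D n\<close> up to a null set, and countably many
  null sets are null together.\<close>

lemma glb_bottomI:
  assumes "\<And>n::nat. meas (D n)" "outer (\<Inter>n. D n) = 0"
  shows "is_glb quot \<bottom>\<^bsub>quot\<^esub> (range (\<lambda>n. cls (D n)))"
  unfolding bottom_quot
proof (rule greatest_LowerI)
  fix Y assume "Y \<in> Lower quot (range (\<lambda>n. cls (D n)))"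
  then obtain G where G: "meas G" "Y = cls G" "\<And>n. cls G \<sqsubseteq>\<^bsub>quot\<^esub> cls (D n)"
    using cls_carrier[OF assms(1)] by (auto simp: Lower_def carrier_quot)
  then have "outer (\<Union>n. G - D n) = 0" using assms(1) by (intro outer_zero_UN) (simp add: le_cls)
  moreover have "G \<subseteq> (\<Union>n. G - D n) \<union> (\<Inter>n. D n)" by blast
  ultimately show "Y \<sqsubseteq>\<^bsub>quot\<^esub> cls {}"
    using G(1,2) assms(2) outer_zeroI[of G "\<Union>n. G - D n" "\<Inter>n. D n"] by (simp add: le_cls meas_empty)
next
  fix X assume "X \<in> range (\<lambda>n. cls (D n))"
  then show "cls {} \<sqsubseteq>\<^bsub>quot\<^esub> X" using cls_mono[OF meas_empty assms(1)] by blast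
qed (use assms(1) meas_empty cls_carrier in blast)+

lemma continuous_quot: "continuous_submeasure quot quot_sub"
  unfolding continuous_submeasure_def
proof (intro conjI allI impI submeasure_quot)
  fix A :: "nat \<Rightarrow> (nat \<Rightarrow> nat) set set"
  assume A: "(\<forall>n. A n \<in> carrier quot) \<and> (\<forall>n. A (Suc n) \<sqsubseteq>\<^bsub>quot\<^esub> A n) \<and> is_glb quot \<bottom>\<^bsub>quot\<^esub> (range A)"
  then have "\<forall>n. \<exists>E. meas E \<and> A n = cls E" using carrier_quot by blast
  then obtain E where E: "\<And>n. meas (E n)" "\<And>n. A n = cls (E n)" by metis
  \<comment> \<open>The chosen representatives decrease only modulo null sets. Intersecting initial
    segments makes them decrease literally without changing the classes.\<close>
  define D where "D n = (\<Inter>i\<in>{..n}. E i)" for n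
  have D: "meas (D n)" for n
    unfolding D_def by (induction n) (simp_all add: E(1) atMost_Suc meas_Int)
  have null: "outer (E n - D n) = 0" for n
  proof (induction n)
    case (Suc n)
    have "outer (E (Suc n) - E n) = 0" using A E by (simp add: le_cls)
    moreover have "E (Suc n) - D (Suc n) \<subseteq> (E (Suc n) - E n) \<union> (E n - D n)"
      by (auto simp: D_def atMost_Suc)
    ultimately show ?case using Suc outer_zeroI by blast
  qed (simp add: D_def outer_empty)
  have AD: "A n = cls (D n)" for n
  proof -
    have "outer (D n - E n) = 0" by (rule outer_zero_mono[OF outer_empty]) (auto simp: D_def)
    then show ?thesis using null[of n] D E by (simp add: cls_eq_iff)
  qed
  have "decseq D" unfolding decseq_def D_def by fastforce
  moreover have "outer (\<Inter>n. D n) = 0"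
  proof -
    have "cls (\<Inter>n. D n) \<in> Lower quot (range A)"
      using D meas_INT[OF D] cls_carrier
      by (auto simp: Lower_def AD le_cls intro!: outer_zero_mono[OF outer_empty])
    then have "cls (\<Inter>n. D n) \<sqsubseteq>\<^bsub>quot\<^esub> \<bottom>\<^bsub>quot\<^esub>" using A by (auto simp: greatest_def)
    then show ?thesis using meas_INT[OF D] by (simp add: bottom_quot le_cls meas_empty)
  qed
  ultimately have "(\<lambda>n. outer (D n)) \<longlonglongrightarrow> 0" by (intro outer_continuous D)
  then show "(\<lambda>n. quot_sub (A n)) \<longlonglongrightarrow> 0" by (simp add: AD quot_sub_cls D)
qed

lemma submeasure_algebra_quot: "submeasure_algebra quot"
proof -
  have "positive_submeasure quot quot_sub"
    unfolding positive_submeasure_def using submeasure_quot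
    by (metis carrier_quot cls_bottom_iff quot_sub_cls)
  then show ?thesis
    unfolding submeasure_algebra_def using sigma_complete_quot submeasure_quot continuous_quot by blast
qed

section \<open>Nonexistence of measures on the quotient\<close>

lemma finadd_measure_pathological:
  assumes "finadd_measure quot \<mu>"
  shows "0 < \<epsilon> \<Longrightarrow> 0 < \<eta> \<Longrightarrow> \<exists>X. clopen X \<and> outer X < \<epsilon> \<and> \<mu> (cls (- X)) < \<eta>"
    and "meas E \<Longrightarrow> 0 \<le> \<mu> (cls E)"
    and "meas E \<Longrightarrow> meas F \<Longrightarrow> E \<subseteq> F \<Longrightarrow> \<mu> (cls E) \<le> \<mu> (cls F)"
    and "meas E \<Longrightarrow> meas F \<Longrightarrow> \<mu> (cls (E \<union> F)) \<le> \<mu> (cls E) + \<mu> (cls F)"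
proof -
  have sub: "submeasure quot \<mu>" using assms by (simp add: finadd_measure_def)
  show nonneg: "0 \<le> \<mu> (cls E)" if "meas E" for E
    using sub cls_carrier[OF that] by (auto simp: submeasure_def)
  show "\<mu> (cls E) \<le> \<mu> (cls F)" if "meas E" "meas F" "E \<subseteq> F" for E F
  proof -
    have "cls E \<sqsubseteq>\<^bsub>quot\<^esub> cls F" using that by (intro cls_mono)
    moreover have "cls E \<in> carrier quot" "cls F \<in> carrier quot" using cls_carrier that by blast+
    ultimately show ?thesis using sub unfolding submeasure_def by blast
  qed
  show "\<mu> (cls (E \<union> F)) \<le> \<mu> (cls E) + \<mu> (cls F)" if "meas E" "meas F" for E F
    using sub cls_carrier that unfolding submeasure_def by (metis join_cls)
  have add: "\<mu> (cls (X \<union> Y)) = \<mu> (cls X) + \<mu> (cls Y)"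
    if "clopen X" "clopen Y" "X \<inter> Y = {}" for X Y
  proof -
    have "cls X \<sqinter>\<^bsub>quot\<^esub> cls Y = \<bottom>\<^bsub>quot\<^esub>"
      using that meas_clopen by (simp add: meet_cls bottom_quot)
    then show ?thesis
      using assms that(1,2) meas_clopen cls_carrier unfolding finadd_measure_def by (metis join_cls)
  qed
  assume "0 < \<epsilon>" "0 < \<eta>"
  then obtain X where "clopen X" "nu X < \<epsilon>" "\<mu> (cls (- X)) < \<eta>"
    using nu_pathological[of "\<lambda>X. \<mu> (cls X)" \<epsilon> \<eta>] nonneg meas_clopen add by blast
  then show "\<exists>X. clopen X \<and> outer X < \<epsilon> \<and> \<mu> (cls (- X)) < \<eta>"
    using outer_clopen_le by (meson order_le_less_trans)
qed

lemma finadd_measure_sequence: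
  assumes "finadd_measure quot \<mu>" "0 < \<epsilon>"
  obtains X :: "nat \<Rightarrow> (nat \<Rightarrow> nat) set"
  where "\<And>k. clopen (X k)" "\<And>k. outer (X k) < \<epsilon> / 2 ^ Suc k"
    "\<And>k. \<mu> (cls (- X k)) < inverse (real (Suc k))"
proof -
  have "\<forall>k. \<exists>X. clopen X \<and> outer X < \<epsilon> / 2 ^ Suc k \<and> \<mu> (cls (- X)) < inverse (real (Suc k))"
    using finadd_measure_pathological(1)[OF assms(1)] assms(2) by simp
  then show ?thesis using that by metis
qed

text \<open>The X k together have \<open>outer\<close> at most 8, less than the 16 of the whole
  space, so the points in none of them form a set Y that is not null. Its measure is below that of
  every complement of X k, hence 0.\<close>

lemma no_positive_measure: "\<not> (finadd_measure quot \<mu> \<and> positive_submeasure quot \<mu>)"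
proof
  assume *: "finadd_measure quot \<mu> \<and> positive_submeasure quot \<mu>"
  then obtain X :: "nat \<Rightarrow> (nat \<Rightarrow> nat) set" where X: "\<And>k. clopen (X k)"
      "\<And>k. outer (X k) < 8 / 2 ^ Suc k" "\<And>k. \<mu> (cls (- X k)) < inverse (real (Suc k))"
    using finadd_measure_sequence[of \<mu> 8] by auto
  define Y where "Y = (\<Inter>k. - X k)"
  have Y: "meas Y" unfolding Y_def using X(1) meas_clopen meas_Compl by (intro meas_INT) blast
  have "\<mu> (cls Y) \<le> inverse (real (Suc k))" for k
  proof -
    have "\<mu> (cls Y) \<le> \<mu> (cls (- X k))"
      using * Y meas_Compl[OF meas_clopen[OF X(1)]]
      by (intro finadd_measure_pathological(3)) (auto simp: Y_def)
    then show ?thesis using X(3)[of k] by simp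
  qed
  then have "\<mu> (cls Y) \<le> 0" by (intro LIMSEQ_le_const[OF LIMSEQ_inverse_real_of_nat]) auto
  then have "\<mu> (cls Y) = 0" using finadd_measure_pathological(2)[of \<mu> Y] * Y by simp
  then have "outer Y = 0"
    using * Y cls_carrier cls_bottom_iff unfolding positive_submeasure_def by blast
  moreover have "outer (\<Union>k. X k) \<le> 8"
    using X(2) sum_halves_le[of 8] by (intro outer_UN) auto
  moreover have "UNIV \<subseteq> (\<Union>k. X k) \<union> Y" by (auto simp: Y_def)
  ultimately show False using outer_le_Un[of UNIV "\<Union>k. X k" Y] outer_UNIV by linarith
qed

text \<open>The X k have summable \<open>outer\<close>, so the tail unions D n decrease to a null
  set and continuity sends their measure to 0. But the measure is almost concentrated on X n
  \<subseteq> D n, so the whole space has measure 0.\<close>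

lemma no_continuous_measure:
  assumes \<mu>: "finadd_measure quot \<mu>" "continuous_submeasure quot \<mu>" and "a \<in> carrier quot"
  shows "\<mu> a = 0"
proof -
  obtain X :: "nat \<Rightarrow> (nat \<Rightarrow> nat) set" where X: "\<And>k. clopen (X k)"
      "\<And>k. outer (X k) < 1 / 2 ^ Suc k" "\<And>k. \<mu> (cls (- X k)) < inverse (real (Suc k))"
    using finadd_measure_sequence[OF \<mu>(1), of 1] by auto
  define D where "D n = (\<Union>k. X (n + k))" for n
  have D: "meas (D n)" for n unfolding D_def using X(1) meas_clopen by (intro meas_UN) blast
  have "outer (D n) \<le> (1/2) ^ n" for n
    unfolding D_def
  proof (rule outer_UN)
    show "outer (X (n + k)) < (1/2) ^ n / 2 ^ Suc k" for k
      using X(2)[of "n + k"] by (simp add: power_add power_one_over field_simps)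
  qed (use sum_halves_le in auto)
  then have "outer (\<Inter>n. D n) \<le> (1/2) ^ n" for n
    using outer_mono[of "\<Inter>n. D n" "D n"] by (meson INT_lower UNIV_I order_trans)
  then have "outer (\<Inter>n. D n) \<le> 0"
    by (intro LIMSEQ_le_const[OF LIMSEQ_realpow_zero[of "1/2"]]) auto
  then have "outer (\<Inter>n. D n) = 0" using outer_nonneg[of "\<Inter>n. D n"] by simp
  then have "is_glb quot \<bottom>\<^bsub>quot\<^esub> (range (\<lambda>n. cls (D n)))" by (rule glb_bottomI[OF D])
  moreover have "cls (D (Suc n)) \<sqsubseteq>\<^bsub>quot\<^esub> cls (D n)" for n
  proof -
    have "X (Suc n + k) \<subseteq> D n" for k unfolding D_def using UN_upper[of "Suc k" UNIV "\<lambda>k. X (n + k)"] by simp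
    then have "D (Suc n) \<subseteq> D n" unfolding D_def[of "Suc n"] by blast
    then show ?thesis using D by (intro cls_mono)
  qed
  ultimately have lim: "(\<lambda>n. \<mu> (cls (D n))) \<longlonglongrightarrow> 0"
    using \<mu>(2)[unfolded continuous_submeasure_def, THEN conjunct2, THEN spec, of "\<lambda>n. cls (D n)"]
      cls_carrier[OF D] by simp
  have "\<mu> (cls UNIV) \<le> \<mu> (cls (D n)) + inverse (real (Suc n))" for n
  proof -
    have "X n \<subseteq> D n" unfolding D_def using UN_upper[of 0 UNIV "\<lambda>k. X (n + k)"] by simp
    then have eq: "UNIV = D n \<union> - X n" by blast
    have "meas (- X n)" using X(1) meas_clopen meas_Compl by blast
    then have "\<mu> (cls UNIV) \<le> \<mu> (cls (D n)) + \<mu> (cls (- X n))"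
      by (subst eq) (intro finadd_measure_pathological(4)[OF \<mu>(1)] D)
    then show ?thesis using X(3)[of n] by simp
  qed
  then have "\<mu> (cls UNIV) \<le> 0 + 0"
    by (intro LIMSEQ_le_const[OF tendsto_add[OF lim LIMSEQ_inverse_real_of_nat]]) auto
  moreover obtain E where E: "meas E" "a = cls E" using assms(3) by (auto simp: carrier_quot)
  ultimately show ?thesis
    using finadd_measure_pathological(2)[OF \<mu>(1) E(1)] finadd_measure_pathological(3)[OF \<mu>(1) E(1) meas_UNIV]
    by simp
qed

theorem theorem1p2:
  shows "\<exists>B :: (nat \<Rightarrow> nat) set set gorder.
    submeasure_algebra B \<and>
    \<not> measure_algebra B \<and>
    \<not> (\<exists>\<mu>. finadd_measure B \<mu> \<and> positive_submeasure B \<mu>) \<and>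
    \<not> (\<exists>\<mu>. finadd_measure B \<mu> \<and> continuous_submeasure B \<mu> \<and> (\<exists>a\<in>carrier B. \<mu> a \<noteq> 0))"
  using submeasure_algebra_quot no_positive_measure no_continuous_measure
  unfolding measure_algebra_def by (intro exI[of _ quot]) blast

end
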